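(* Let $X$ be an infinite ultrahomogeneous chain with the order topology and $G=(\mathrm{Aut}(X),\tau_p)$. Then: (a) the Ellis compactification $e_{c_mX}G$ is the completion of $(G,R_{\Sigma_{c_mX}})$ (i.e. $\mathcal V_G=R_{\Sigma_{c_mX}}$); (b) $G$ is Roelcke precompact and $b_rG<e_{c_mX}G$ (strictly); (c) $e_{c_mX}G$ is the set of all non-decreasing maps $f:c_mX\to c_mX$ ($x<y\Rightarrow f(x)\leq f(y)$) with $f(\inf)=\inf$ and $f(\sup)=\sup$, with the topology of pointwise convergence. If moreover $X$ is continuously ordered, then $e_{c_mX}G$ is the completion of $(G,R_{\Sigma_X})$.
   Context: Ultrahomogeneous chain: for all $x_1<\dots<x_n$, $y_1<\dots<y_n$ there is an order automorphism with $g(x_k)=y_k$. $\tau_p$: topology of pointwise convergence. $c_mX$: $X$ plus one point per gap (cut $(A,B)$, $A<B$, $A$ without max, $B$ without min, including $\inf$ ($A=\emptyset$) and $\sup$ ($B=\emptyset$)), with order topology; $G$ acts on it by extension. For a compact $K$ on which $G$ acts, $e_KG$ is the closure of $\iota_K(G)$, $\iota_K(g)(x)=gx$, in $K^K$ (product topology), and $\mathcal V_G$ is the uniformity on $G$ transported from the subspace product uniformity on $\iota_K(G)$. For a $G$-set $Z$, $\mathrm{St}_\sigma=\{g: gz=z\ \forall z\in\sigma\}$ and $R_{\Sigma_Z}$ is the uniformity on $G$ with base covers $\{Og\,\mathrm{St}_\sigma:g\in G\}$, $O$ a neighbourhood of $e$, $\sigma\subset Z$ finite nonempty. Roelcke precompact: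 the uniformity with base covers $\{OgO: g\in G\}$ is totally bounded; $b_rG$ is then the completion of $G$ in it. Continuously ordered: densely ordered with no proper gaps. *)

theory Defs
  imports "HOL-Analysis.Analysis"
begin

text \<open>The chain X is the whole carrier of a type 'a of class linorder_topology,
  so its topology is the order topology.\<close>

definition Aut :: "('a::linorder \<Rightarrow> 'a) set" where
  "Aut = {g. strict_mono g \<and> surj g}"

definition ultrahomogeneous :: "'a::linorder itself \<Rightarrow> bool" where
  "ultrahomogeneous _ \<longleftrightarrow>
     (\<forall>xs ys :: 'a list. length xs = length ys \<and> sorted_wrt (<) xs \<and> sorted_wrt (<) ys \<longrightarrow>
        (\<exists>g\<in>Aut. \<forall>k<length xs. g (xs ! k) = ys ! k))"

definition tau_p :: "('a::linorder_topology \<Rightarrow> 'a) topology" where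
  "tau_p = subtopology (product_topology (\<lambda>_. euclidean) UNIV) Aut"

text \<open>A point of c_m X is represented by a down-closed subset of X:
  the point x is represented by {..x}; a gap (A,B) is represented by A
  (A has no maximum, B = -A has no minimum); inf is {} and sup is UNIV.
  The order of c_m X is inclusion.\<close>

definition down_closed :: "'a::linorder set \<Rightarrow> bool" where
  "down_closed A \<longleftrightarrow> (\<forall>a\<in>A. \<forall>b. b \<le> a \<longrightarrow> b \<in> A)"

definition is_gap :: "'a::linorder set \<Rightarrow> bool" where
  "is_gap A \<longleftrightarrow> down_closed A \<and> (\<forall>a\<in>A. \<exists>a'\<in>A. a < a') \<and> (\<forall>b\<in>-A. \<exists>b'\<in>-A. b' < b)"

definition cmX :: "'a::linorder set set" where
  "cmX = range atMost \<union> {A. is_gap A} \<union> {{}, UNIV}"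

definition cm_top :: "'a::linorder set topology" where
  "cm_top = topology_generated_by
     ({cmX} \<union> (\<lambda>q. {p\<in>cmX. p \<subset> q}) ` cmX \<union> (\<lambda>q. {p\<in>cmX. q \<subset> p}) ` cmX)"

definition cm_act :: "('a \<Rightarrow> 'a) \<Rightarrow> 'a set \<Rightarrow> 'a set" where
  "cm_act g A = g ` A"

definition iota_cm :: "('a::linorder \<Rightarrow> 'a) \<Rightarrow> ('a set \<Rightarrow> 'a set)" where
  "iota_cm g = restrict (cm_act g) cmX"

definition ellis_cm :: "('a::linorder_topology set \<Rightarrow> 'a set) set" where
  "ellis_cm = (product_topology (\<lambda>_. cm_top) cmX) closure_of (iota_cm ` Aut)"

text \<open>Uniformity V_G transported from the subspace product uniformity on
  iota(G) in K^K, where the compact space K = c_m X carries its unique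
  uniformity (entourages = neighbourhoods of the diagonal).\<close>
definition V_G :: "('a::linorder_topology \<Rightarrow> 'a) set \<Rightarrow> (('a \<Rightarrow> 'a) \<times> ('a \<Rightarrow> 'a)) set set" where
  "V_G G = {E. E \<subseteq> G \<times> G \<and>
     (\<exists>\<sigma> W. finite \<sigma> \<and> \<sigma> \<subseteq> cmX \<and> openin (prod_topology cm_top cm_top) W \<and>
        (\<forall>z\<in>cmX. (z, z) \<in> W) \<and>
        {(g, h). g \<in> G \<and> h \<in> G \<and> (\<forall>z\<in>\<sigma>. (cm_act g z, cm_act h z) \<in> W)} \<subseteq> E)}"

definition dcoset :: "('a \<Rightarrow> 'a) set \<Rightarrow> ('a \<Rightarrow> 'a) \<Rightarrow> ('a \<Rightarrow> 'a) set \<Rightarrow> ('a \<Rightarrow> 'a) set" where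
  "dcoset A g B = {a \<circ> g \<circ> b | a b. a \<in> A \<and> b \<in> B}"

definition Stab :: "('a \<Rightarrow> 'a) set \<Rightarrow> (('a \<Rightarrow> 'a) \<Rightarrow> 'z \<Rightarrow> 'z) \<Rightarrow> 'z set \<Rightarrow> ('a \<Rightarrow> 'a) set" where
  "Stab G act \<sigma> = {g\<in>G. \<forall>z\<in>\<sigma>. act g z = z}"

definition unif_of_cover_base ::
  "'b set \<Rightarrow> 'b set set set \<Rightarrow> ('b \<times> 'b) set set" where
  "unif_of_cover_base G B = {E. E \<subseteq> G \<times> G \<and> (\<exists>\<C>\<in>B. (\<Union>C\<in>\<C>. C \<times> C) \<subseteq> E)}"

definition R_Sigma ::
  "('a \<Rightarrow> 'a) set \<Rightarrow> ('a \<Rightarrow> 'a) topology \<Rightarrow> (('a \<Rightarrow> 'a) \<Rightarrow> 'z \<Rightarrow> 'z) \<Rightarrow> 'z set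
     \<Rightarrow> (('a \<Rightarrow> 'a) \<times> ('a \<Rightarrow> 'a)) set set" where
  "R_Sigma G T act Z = unif_of_cover_base G
     {(\<lambda>g. dcoset U g (Stab G act \<sigma>)) ` G | U \<sigma>.
        openin T U \<and> id \<in> U \<and> finite \<sigma> \<and> \<sigma> \<noteq> {} \<and> \<sigma> \<subseteq> Z}"

definition Roelcke_unif ::
  "('a \<Rightarrow> 'a) set \<Rightarrow> ('a \<Rightarrow> 'a) topology \<Rightarrow> (('a \<Rightarrow> 'a) \<times> ('a \<Rightarrow> 'a)) set set" where
  "Roelcke_unif G T = unif_of_cover_base G
     {(\<lambda>g. dcoset U g U) ` G | U. openin T U \<and> id \<in> U}"

definition Roelcke_precompact :: "('a \<Rightarrow> 'a) set \<Rightarrow> ('a \<Rightarrow> 'a) topology \<Rightarrow> bool" where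
  "Roelcke_precompact G T \<longleftrightarrow>
     (\<forall>U. openin T U \<and> id \<in> U \<longrightarrow> (\<exists>F. finite F \<and> F \<subseteq> G \<and> G \<subseteq> (\<Union>g\<in>F. dcoset U g U)))"

definition continuously_ordered :: "'a::linorder itself \<Rightarrow> bool" where
  "continuously_ordered _ \<longleftrightarrow>
     (\<forall>x y::'a. x < y \<longrightarrow> (\<exists>z. x < z \<and> z < y)) \<and>
     \<not> (\<exists>A::'a set. is_gap A \<and> A \<noteq> {} \<and> A \<noteq> UNIV)"

end

theory Submission
  imports Defs
begin

text \<open>
  Ultrahomogeneity makes \<open>X\<close> dense without endpoints, so between any two points of \<open>c_m X\<close> there
  is a point of \<open>X\<close>.

  Compactness of \<open>c_m X\<close> and continuity of the action give a neighbourhood of the identity moving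
  every point by a prescribed small amount, hence \<open>V_G \<subseteq> R_\<Sigma>\<close>.
  Conversely, if \<open>g z\<close> and \<open>h z\<close> are close for all \<open>z\<close> in a finite set \<open>\<sigma>\<close>, ultrahomogeneity
  corrects \<open>g h\<^sup>-\<^sup>1\<close> on the right by an automorphism fixing the cuts \<open>h z\<close>, so that the product
  moves finitely many given points of \<open>X\<close> only slightly; this puts \<open>g\<close> into \<open>O h St_\<sigma>\<close>.

  A double coset of the stabiliser of a finite \<open>S \<subseteq> X\<close> is determined by the relative order of \<open>S\<close>
  and \<open>g S\<close>, of which there are finitely many types. The Roelcke uniformity is strictly coarser,
  since some \<open>u\<close> near the identity has \<open>x < u x\<close> while a suitable \<open>k\<close> spreads \<open>x\<close> and \<open>u x\<close> to two
  given points.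

  Monotonicity is a closed condition. A monotone map is approximated at finitely many cuts by
  separating the cuts by points of \<open>X\<close> and mapping these to strictly increasing points slightly
  above the prescribed values; the value \<open>sup\<close> is first replaced by a large point of \<open>X\<close>.
\<close>

section \<open>Automorphisms and the compactification\<close>

lemma id_in_Aut: "id \<in> Aut"
  by (simp add: Aut_def strict_mono_def)

lemma comp_in_Aut: "g \<in> Aut \<Longrightarrow> h \<in> Aut \<Longrightarrow> g \<circ> h \<in> Aut"
  using comp_surj[of h g] by (simp add: Aut_def strict_mono_def comp_def)

lemma Aut_less_iff: "g \<in> Aut \<Longrightarrow> g x < g y \<longleftrightarrow> x < y"
  by (simp add: Aut_def strict_mono_less)

lemma Aut_le_iff: "g \<in> Aut \<Longrightarrow> g x \<le> g y \<longleftrightarrow> x \<le> y"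
  by (simp add: Aut_def strict_mono_less_eq)

lemma Aut_bij: "g \<in> Aut \<Longrightarrow> bij g"
  by (simp add: Aut_def bij_def strict_mono_imp_inj_on)

lemma Aut_inj: "g \<in> Aut \<Longrightarrow> inj g"
  by (simp add: Aut_bij bij_is_inj)

lemma Aut_surj: "g \<in> Aut \<Longrightarrow> surj g"
  by (simp add: Aut_def)

lemma Aut_inv_apply: "g \<in> Aut \<Longrightarrow> inv g (g x) = x"
  by (simp add: Aut_inj)

lemma Aut_apply_inv: "g \<in> Aut \<Longrightarrow> g (inv g x) = x"
  by (simp add: Aut_surj surj_f_inv_f)

lemma inv_in_Aut:
  assumes "g \<in> Aut" shows "inv g \<in> Aut"
proof -
  have "inv g x < inv g y" if "x < y" for x y
    using that Aut_less_iff[OF assms, of "inv g x" "inv g y"] by (simp add: Aut_apply_inv assms)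
  then show ?thesis
    using bij_imp_bij_inv[OF Aut_bij[OF assms]] by (simp add: Aut_def strict_mono_def bij_is_surj)
qed

lemma Aut_image_atMost:
  assumes "g \<in> Aut" shows "g ` {..x} = {..g x}"
proof -
  have "y \<in> g ` {..x}" if "y \<le> g x" for y
    using that Aut_le_iff[OF assms, of "inv g y" x] Aut_apply_inv[OF assms, of y]
    by (metis atMost_iff image_eqI)
  then show ?thesis by (auto simp: Aut_le_iff assms)
qed

lemma Aut_image_psubset: "g \<in> Aut \<Longrightarrow> g ` p \<subset> g ` q \<longleftrightarrow> p \<subset> q"
  by (simp add: Aut_inj inj_image_subset_iff psubset_eq inj_image_eq_iff)

lemma Aut_image_eq: "g \<in> Aut \<Longrightarrow> g ` p = g ` q \<longleftrightarrow> p = q"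
  by (simp add: Aut_inj inj_image_eq_iff)

lemma Aut_inv_image: "g \<in> Aut \<Longrightarrow> inv g ` g ` p = p"
  by (simp add: Aut_inj image_image)

lemma Aut_image_mem_iff: "g \<in> Aut \<Longrightarrow> b \<in> g ` p \<longleftrightarrow> inv g b \<in> p"
  using Aut_apply_inv[of g b] Aut_inv_apply[of g] by (auto intro: rev_image_eqI)

lemma Aut_image_gap:
  assumes g: "g \<in> Aut" and p: "is_gap p" shows "is_gap (g ` p)"
proof -
  note gap = p[unfolded is_gap_def]
  note dc = gap[THEN conjunct1] and up = gap[THEN conjunct2, THEN conjunct1]
    and dn = gap[THEN conjunct2, THEN conjunct2]
  have "down_closed (g ` p)"
    using dc Aut_le_iff[OF inv_in_Aut[OF g]]
    unfolding down_closed_def Ball_def Aut_image_mem_iff[OF g] by simp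
  moreover have "\<exists>a'\<in>g ` p. a < a'" if "a \<in> g ` p" for a
  proof -
    obtain c where c: "c \<in> p" "a = g c" using \<open>a \<in> g ` p\<close> by (rule imageE)
    obtain c' where "c' \<in> p" "c < c'" using bspec[OF up c(1)] by (rule bexE)
    then show ?thesis using c(2) by (auto simp: Aut_less_iff[OF g])
  qed
  moreover have "\<exists>b'\<in>- g ` p. b' < b" if "b \<in> - g ` p" for b
  proof -
    have "inv g b \<in> - p" using that by (simp add: Aut_image_mem_iff g)
    from bspec[OF dn this] obtain c' where c': "c' \<in> - p" "c' < inv g b" by (rule bexE)
    have "g c' < b"
      using c'(2) Aut_less_iff[OF g, of c' "inv g b"] by (simp add: Aut_apply_inv[OF g])
    moreover have "g c' \<in> - g ` p"
      using c'(1) by (simp add: inj_image_mem_iff[OF Aut_inj[OF g]])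
    ultimately show ?thesis by (rule rev_bexI[rotated])
  qed
  ultimately show ?thesis by (simp only: is_gap_def ball_simps simp_thms) simp
qed

lemma Aut_image_cmX: "g \<in> Aut \<Longrightarrow> p \<in> cmX \<Longrightarrow> g ` p \<in> cmX"
  using Aut_image_gap[of g p] Aut_image_atMost[of g] Aut_surj[of g] by (auto simp: cmX_def)

section \<open>The chain of cuts and its order topology\<close>

lemma atMost_in_cmX [simp]: "{..x} \<in> cmX"
  and empty_in_cmX [simp]: "{} \<in> cmX"
  and UNIV_in_cmX [simp]: "UNIV \<in> cmX"
  by (auto simp: cmX_def)

lemma cmX_down_closed: "p \<in> cmX \<Longrightarrow> y \<in> p \<Longrightarrow> x \<le> y \<Longrightarrow> x \<in> p"
  by (auto simp: cmX_def is_gap_def down_closed_def)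

lemma cmX_not_mem_subset_atMost: "p \<in> cmX \<Longrightarrow> x \<notin> p \<Longrightarrow> p \<subseteq> {..x}"
  using cmX_down_closed by (metis atMost_iff linear subsetI)

lemma cmX_linear: "p \<in> cmX \<Longrightarrow> q \<in> cmX \<Longrightarrow> p \<subseteq> q \<or> q \<subseteq> p"
  by (meson cmX_down_closed linear subsetI)

lemma cmX_not_subset: "p \<in> cmX \<Longrightarrow> q \<in> cmX \<Longrightarrow> \<not> p \<subseteq> q \<longleftrightarrow> q \<subset> p"
  using cmX_linear by blast

lemma atMost_psubset_atMost: "{..x} \<subset> {..y} \<longleftrightarrow> x < (y :: 'a :: linorder)"
  by (auto simp: psubset_eq)

lemma cmX_finite_maximum:
  assumes "finite A" "A \<noteq> {}" "A \<subseteq> cmX"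
  obtains m where "m \<in> A" "\<And>a. a \<in> A \<Longrightarrow> a \<subseteq> m"
  using finite_has_maximal[OF assms(1,2)] assms(3) cmX_linear by (metis subsetD)

lemma cmX_finite_minimum:
  assumes "finite A" "A \<noteq> {}" "A \<subseteq> cmX"
  obtains m where "m \<in> A" "\<And>a. a \<in> A \<Longrightarrow> m \<subseteq> a"
  using finite_has_minimal[OF assms(1,2)] assms(3) cmX_linear by (metis subsetD)

lemma topspace_cm_top [simp]: "topspace cm_top = cmX"
  by (auto simp: cm_top_def topology_generated_by_topspace)

lemma openin_cm_less: "q \<in> cmX \<Longrightarrow> openin cm_top {p \<in> cmX. p \<subset> q}"
  and openin_cm_greater: "q \<in> cmX \<Longrightarrow> openin cm_top {p \<in> cmX. q \<subset> p}"
  unfolding cm_top_def by (rule topology_generated_by_Basis, blast)+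

lemma openin_cm_interval:
  assumes "p \<in> cmX" "q \<in> cmX"
  shows "openin cm_top {r \<in> cmX. p \<subset> r \<and> r \<subset> q}"
proof -
  have "{r \<in> cmX. p \<subset> r \<and> r \<subset> q} = {r \<in> cmX. p \<subset> r} \<inter> {r \<in> cmX. r \<subset> q}"
    by auto
  then show ?thesis
    using assms by (simp add: openin_Int openin_cm_less openin_cm_greater)
qed

section \<open>Pointwise topology and entourages of the coset uniformities\<close>

lemma topspace_tau_p [simp]: "topspace tau_p = Aut"
  by (simp add: tau_p_def)

lemma openin_tau_p_eval:
  assumes "open V"
  shows "openin tau_p {g \<in> Aut. g x \<in> V}"
proof -
  have "openin (product_topology (\<lambda>_. euclidean) UNIV) {g. g x \<in> V}"
    using openin_continuous_map_preimage[OF continuous_map_product_projection[of x UNIV "\<lambda>_. euclidean"]]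
      assms by simp
  then show ?thesis
    unfolding tau_p_def openin_subtopology by auto
qed

lemma id_in_Stab: "id \<in> Stab Aut act \<sigma>" if "\<And>z. z \<in> \<sigma> \<Longrightarrow> act id z = z"
  using that by (simp add: Stab_def id_in_Aut)

lemma mem_Roelcke_unif_iff:
  "E \<in> Roelcke_unif H T \<longleftrightarrow> E \<subseteq> H \<times> H \<and>
    (\<exists>U. openin T U \<and> id \<in> U \<and> (\<forall>g\<in>H. dcoset U g U \<times> dcoset U g U \<subseteq> E))"
  unfolding Roelcke_unif_def unif_of_cover_base_def by fastforce

lemma mem_R_Sigma_iff:
  "E \<in> R_Sigma H T act Z \<longleftrightarrow> E \<subseteq> H \<times> H \<and>
    (\<exists>U \<sigma>. openin T U \<and> id \<in> U \<and> finite \<sigma> \<and> \<sigma> \<noteq> {} \<and> \<sigma> \<subseteq> Z \<and>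
      (\<forall>g\<in>H. dcoset U g (Stab H act \<sigma>) \<times> dcoset U g (Stab H act \<sigma>) \<subseteq> E))"
  unfolding R_Sigma_def unif_of_cover_base_def by fastforce

section \<open>Dense chains without endpoints\<close>

text \<open>Separates what follows from density and the absence of endpoints from what requires
  extending partial maps; every infinite ultrahomogeneous chain is an instance.\<close>

locale dense_chain =
  fixes type :: "'a :: linorder_topology itself"
  assumes dense: "x < y \<Longrightarrow> \<exists>z :: 'a. x < z \<and> z < y"
    and gt_ex: "\<exists>y :: 'a. x < y"
    and lt_ex: "\<exists>y :: 'a. y < x"
begin

abbreviation G :: "('a \<Rightarrow> 'a) set" where "G \<equiv> Aut"
abbreviation K :: "'a set set" where "K \<equiv> cmX"

section \<open>Separation and completeness in c_m X\<close>

text \<open>The complement of \<open>{..<x}\<close> has the minimum x, so this set is no gap, and by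
  density it has no maximum. Its exclusion keeps x from having an immediate predecessor in c_m
  X.\<close>

lemma lessThan_not_in_K: "{..<x :: 'a} \<notin> K"
proof
  assume "{..<x} \<in> K"
  then consider y where "{..<x} = {..y}" | "is_gap {..<x}" | "{..<x} = {}" | "{..<x} = UNIV"
    by (auto simp: cmX_def)
  then show False
  proof cases
    case 1
    then have "y < x" by auto
    then obtain z where "y < z" "z < x" using dense by blast
    with 1 show False by (metis atMost_iff lessThan_iff not_le)
  next
    case 2
    then obtain b where "b \<in> - {..<x}" "b < x"
      by (metis ComplI is_gap_def lessThan_iff less_irrefl)
    then show False by simp
  next
    case 3
    then show False using lt_ex[of x] by auto
  next
    case 4
    then show False by auto
  qed
qed

lemma atMost_neq: "{} \<noteq> {..x :: 'a}" "UNIV \<noteq> {..x :: 'a}"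
proof -
  show "{} \<noteq> {..x}" by auto
  obtain y where "x < y" using gt_ex by blast
  then show "UNIV \<noteq> {..x}" by (metis UNIV_I atMost_iff not_le)
qed

lemma K_dense:
  assumes p: "p \<in> K" and q: "q \<in> K" and "p \<subset> q"
  obtains y where "p \<subset> {..y}" "{..y} \<subset> q"
proof -
  obtain x where x: "x \<in> q" "x \<notin> p" using assms by auto
  have px: "p \<subseteq> {..x}" and xq: "{..x} \<subseteq> q"
    using x cmX_not_mem_subset_atMost p cmX_down_closed[OF q] by auto
  show thesis
  proof (cases "q = {..x}")
    case False
    then obtain x' where x': "x' \<in> q" "x < x'" using xq by (metis atMost_iff not_le subsetI subset_antisym)
    then obtain y where y: "x < y" "y < x'" using dense by blast
    have "{..x'} \<subseteq> q" using x' cmX_down_closed q by auto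
    then show thesis
      using that[of y] px y atMost_psubset_atMost by (metis order_le_less_trans order_less_le_trans)
  next
    case True
    \<comment> \<open>Now \<open>q\<close> is x itself, and y must be found below x. As
      \<open>{..<x}\<close> is not in c_m X, \<open>p\<close> omits some x' < x, and any y between
      x' and x works.\<close>
    have "p \<noteq> {..<x}" using lessThan_not_in_K p by metis
    moreover have "p \<subseteq> {..<x}" using px x by (metis atMost_iff lessThan_iff order_le_less subset_iff)
    ultimately obtain x' where x': "x' < x" "x' \<notin> p" by auto
    then obtain y where y: "x' < y" "y < x" using dense by blast
    have "p \<subseteq> {..x'}"
      using x' cmX_not_mem_subset_atMost p by blast
    then show thesis
      using that[of y] True y atMost_psubset_atMost by (metis order_le_less_trans)
  qed
qed

text \<open>Only the largest element of A and the smallest of B matter, and \<open>K_dense\<close>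
  separates these. Adjoining \<open>{}\<close> and \<open>UNIV\<close> supplies them for empty
  families; excluding \<open>UNIV\<close> from A and \<open>{}\<close> from B keeps the separation
  strict in that case.\<close>

lemma K_between_finite:
  assumes "finite A" "finite B" "A \<subseteq> K" "B \<subseteq> K"
    and "\<forall>a\<in>A. \<forall>b\<in>B. a \<subset> b" "UNIV \<notin> A" "{} \<notin> B"
  shows "\<exists>y. (\<forall>a\<in>A. a \<subset> {..y}) \<and> (\<forall>b\<in>B. {..y} \<subset> b)"
proof -
  obtain m where m: "m \<in> insert {} A" "\<And>a. a \<in> insert {} A \<Longrightarrow> a \<subseteq> m"
    by (rule cmX_finite_maximum[of "insert {} A"]) (use assms in auto)
  obtain n where n: "n \<in> insert UNIV B" "\<And>b. b \<in> insert UNIV B \<Longrightarrow> n \<subseteq> b"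
    by (rule cmX_finite_minimum[of "insert UNIV B"]) (use assms in auto)
  have "m \<in> K" "n \<in> K" using m n assms by auto
  moreover have "m \<subset> n" using m(1) n(1) assms(5,6,7) by blast
  ultimately obtain y where "m \<subset> {..y}" "{..y} \<subset> n" using K_dense by blast
  then show ?thesis
    using m(2) n(2) by (meson insertI2 order_le_less_trans order_less_le_trans)
qed

lemma between_finite:
  fixes A B :: "'a set"
  assumes "finite A" "finite B" "\<forall>a\<in>A. \<forall>b\<in>B. a < b"
  shows "\<exists>y. (\<forall>a\<in>A. a < y) \<and> (\<forall>b\<in>B. y < b)"
proof -
  have "UNIV \<notin> atMost ` A" "{} \<notin> atMost ` B" using atMost_neq by auto
  then have "\<exists>y. (\<forall>a\<in>atMost ` A. a \<subset> {..y}) \<and> (\<forall>b\<in>atMost ` B. {..y} \<subset> b)"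
    by (intro K_between_finite) (use assms in \<open>simp_all add: atMost_psubset_atMost image_subset_iff\<close>)
  then show ?thesis by (simp add: atMost_psubset_atMost)
qed

text \<open>The union is the natural supremum. It can fail to lie in c_m X only by being some
  \<open>{..<x}\<close>, and then \<open>{..x}\<close> is the least upper bound, because an upper
  bound in c_m X differs from \<open>{..<x}\<close>.\<close>

lemma K_sup:
  assumes "Y \<subseteq> K"
  obtains s where "s \<in> K" "\<And>p. p \<in> Y \<Longrightarrow> p \<subseteq> s" "\<And>q. q \<in> K \<Longrightarrow> (\<And>p. p \<in> Y \<Longrightarrow> p \<subseteq> q) \<Longrightarrow> s \<subseteq> q"
proof (cases "\<Union>Y \<in> K")
  case True
  then show thesis using that[of "\<Union>Y"] by blast
next
  case False
  have dc: "down_closed (\<Union>Y)"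
    using assms cmX_down_closed unfolding down_closed_def by blast
  have nomax: "\<exists>a'\<in>\<Union>Y. a < a'" if "a \<in> \<Union>Y" for a
  proof (rule ccontr)
    assume "\<not> (\<exists>a'\<in>\<Union>Y. a < a')"
    then have "\<Union>Y = {..a}" using dc that unfolding down_closed_def by (meson atMost_iff not_le subsetI subset_antisym)
    then show False using False by simp
  qed
  have "\<not> is_gap (\<Union>Y)" using False by (auto simp: cmX_def)
  then have "\<not> (\<forall>b\<in>-\<Union>Y. \<exists>b'\<in>-\<Union>Y. b' < b)"
    using dc nomax unfolding is_gap_def by metis
  then obtain x where x: "x \<notin> \<Union>Y" "\<And>b. b \<notin> \<Union>Y \<Longrightarrow> \<not> b < x"
    by (metis ComplI ComplD)
  have eq: "\<Union>Y = {..<x}"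
    using x dc unfolding down_closed_def by (metis lessThan_iff not_le subsetI subset_antisym)
  show thesis
  proof (rule that[of "{..x}"])
    show "p \<subseteq> {..x}" if "p \<in> Y" for p
      using Union_upper[OF that] eq by (metis atMost_iff lessThan_iff less_imp_le subset_iff)
    show "{..x} \<subseteq> q" if q: "q \<in> K" "\<And>p. p \<in> Y \<Longrightarrow> p \<subseteq> q" for q
    proof -
      have "{..<x} \<subseteq> q" using q(2) eq by blast
      moreover have "q \<noteq> {..<x}" using lessThan_not_in_K q(1) by metis
      ultimately obtain z where "z \<in> q" "x \<le> z" by (metis lessThan_iff not_le subsetI subset_antisym)
      then show ?thesis using cmX_down_closed[OF q(1)] by (meson atMost_iff order_trans subsetI)
    qed
  qed simp
qed

section \<open>One-sided neighbourhoods and continuity of the action at the identity\<close>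

text \<open>By induction on the generation of the topology from rays: intersections take the larger
  endpoint, unions keep one, and density lets the endpoint be chosen in X. Treating one side at a
  time isolates the special role of inf.\<close>

lemma openin_cm_left:
  assumes "openin cm_top V" "p \<in> V" "p \<noteq> ({} :: 'a set)"
  obtains l where "{..l} \<subset> p" "\<And>q. q \<in> K \<Longrightarrow> {..l} \<subset> q \<Longrightarrow> q \<subseteq> p \<Longrightarrow> q \<in> V"
proof -
  have gen: "generate_topology_on
     ({K} \<union> (\<lambda>q. {p\<in>K. p \<subset> q}) ` K \<union> (\<lambda>q. {p\<in>K. q \<subset> p}) ` K) V"
    using assms(1) by (simp add: cm_top_def openin_topology_generated_by_iff)
  have pK: "p \<in> K" using assms openin_subset[OF assms(1)] by auto
  have "\<exists>l. {..l} \<subset> p \<and> (\<forall>q\<in>K. {..l} \<subset> q \<and> q \<subseteq> p \<longrightarrow> q \<in> V)"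
    using gen assms(2)
  proof (induction rule: generate_topology_on.induct)
    case (Int a b)
    then obtain l l' where l: "{..l} \<subset> p" "\<forall>q\<in>K. {..l} \<subset> q \<and> q \<subseteq> p \<longrightarrow> q \<in> a"
      and l': "{..l'} \<subset> p" "\<forall>q\<in>K. {..l'} \<subset> q \<and> q \<subseteq> p \<longrightarrow> q \<in> b" by blast
    have "{..l} \<subseteq> {..max l l'}" "{..l'} \<subseteq> {..max l l'}" "{..max l l'} \<subset> p"
      using l(1) l'(1) by (auto simp: max_def)
    then show ?case using l(2) l'(2) by (meson IntI order_le_less_trans)
  next
    case (UN A)
    then obtain k where k: "k \<in> A" "p \<in> k" by blast
    from UN.IH[OF k] show ?case
      by (rule ex_forward) (use k(1) in blast)
  next
    case (Basis s)
    have *: "\<exists>l. {..l} \<subset> p" using K_dense[of "{}" p] pK assms(3) by auto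
    from Basis(1) consider "s = K" | q where "q \<in> K" "s = {p\<in>K. p \<subset> q}" | q where "q \<in> K" "s = {p\<in>K. q \<subset> p}"
      by blast
    then show ?case
    proof cases
      case 1
      then show ?thesis using * by blast
    next
      case (2 q)
      then have "p \<subset> q" using Basis(2) by simp
      moreover have "q' \<in> s" if "q' \<in> K" "q' \<subseteq> p" for q'
        using that 2(2) \<open>p \<subset> q\<close> by (simp add: order_le_less_trans)
      ultimately show ?thesis using * by blast
    next
      case (3 q)
      then have "q \<subset> p" using Basis(2) by auto
      then obtain l where "q \<subset> {..l}" "{..l} \<subset> p" using K_dense[of q p] 3 pK by metis
      moreover have "q' \<in> s" if "q' \<in> K" "{..l} \<subset> q'" for q'
        using that 3(2) \<open>q \<subset> {..l}\<close> by (simp add: order_less_trans)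
      ultimately show ?thesis by blast
    qed
  qed simp
  then obtain l where *: "{..l} \<subset> p" "\<forall>q\<in>K. {..l} \<subset> q \<and> q \<subseteq> p \<longrightarrow> q \<in> V"
    by (elim exE conjE)
  show thesis
    by (rule that[OF *(1)]) (simp add: *(2))
qed

text \<open>Dual of \<open>openin_cm_left\<close>: intersections take the smaller endpoint, and sup
  is the exceptional point.\<close>

lemma openin_cm_right:
  assumes "openin cm_top V" "p \<in> V" "p \<noteq> (UNIV :: 'a set)"
  obtains r where "p \<subset> {..r}" "\<And>q. q \<in> K \<Longrightarrow> q \<subset> {..r} \<Longrightarrow> p \<subseteq> q \<Longrightarrow> q \<in> V"
proof -
  have gen: "generate_topology_on
     ({K} \<union> (\<lambda>q. {p\<in>K. p \<subset> q}) ` K \<union> (\<lambda>q. {p\<in>K. q \<subset> p}) ` K) V"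
    using assms(1) by (simp add: cm_top_def openin_topology_generated_by_iff)
  have pK: "p \<in> K" using assms openin_subset[OF assms(1)] by auto
  have "\<exists>r. p \<subset> {..r} \<and> (\<forall>q\<in>K. q \<subset> {..r} \<and> p \<subseteq> q \<longrightarrow> q \<in> V)"
    using gen assms(2)
  proof (induction rule: generate_topology_on.induct)
    case (Int a b)
    then obtain l l' where l: "p \<subset> {..l}" "\<forall>q\<in>K. q \<subset> {..l} \<and> p \<subseteq> q \<longrightarrow> q \<in> a"
      and l': "p \<subset> {..l'}" "\<forall>q\<in>K. q \<subset> {..l'} \<and> p \<subseteq> q \<longrightarrow> q \<in> b" by blast
    have "{..min l l'} \<subseteq> {..l}" "{..min l l'} \<subseteq> {..l'}" "p \<subset> {..min l l'}"
      using l(1) l'(1) by (auto simp: min_def)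
    then show ?case using l(2) l'(2) by (meson IntI order_less_le_trans)
  next
    case (UN A)
    then obtain k where k: "k \<in> A" "p \<in> k" by blast
    from UN.IH[OF k] show ?case
      by (rule ex_forward) (use k(1) in blast)
  next
    case (Basis s)
    have *: "\<exists>l. p \<subset> {..l}" using K_dense[of p UNIV] pK assms(3) by auto
    from Basis(1) consider "s = K" | q where "q \<in> K" "s = {p\<in>K. p \<subset> q}" | q where "q \<in> K" "s = {p\<in>K. q \<subset> p}"
      by blast
    then show ?case
    proof cases
      case 1
      then show ?thesis using * by blast
    next
      case (2 q)
      then have "p \<subset> q" using Basis(2) by auto
      then obtain l where "p \<subset> {..l}" "{..l} \<subset> q" using K_dense[of p q] 2 pK by metis
      moreover have "q' \<in> s" if "q' \<in> K" "q' \<subset> {..l}" for q'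
        using that 2(2) \<open>{..l} \<subset> q\<close> by (simp add: order_less_trans)
      ultimately show ?thesis by blast
    next
      case (3 q)
      then have "q \<subset> p" using Basis(2) by simp
      moreover have "q' \<in> s" if "q' \<in> K" "p \<subseteq> q'" for q'
        using that 3(2) \<open>q \<subset> p\<close> by (simp add: order_less_le_trans)
      ultimately show ?thesis using * by blast
    qed
  qed simp
  then obtain r where *: "p \<subset> {..r}" "\<forall>q\<in>K. q \<subset> {..r} \<and> p \<subseteq> q \<longrightarrow> q \<in> V"
    by (elim exE conjE)
  show thesis
    by (rule that[OF *(1)]) (simp add: *(2))
qed

text \<open>With l < m < p, the conditions m < q and l < u m give l < u m < u q, so u q stays to the
  right of l. At p = inf, having u q below p already forces u q = p.\<close>

lemma action_left:
  assumes "openin cm_top V" "p \<in> V"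
  obtains I U where "openin cm_top I" "p \<in> I" "openin tau_p U" "id \<in> U"
    "\<And>q u. q \<in> I \<Longrightarrow> u \<in> U \<Longrightarrow> u ` q \<subseteq> p \<Longrightarrow> u ` q \<in> (V :: 'a set set)"
proof (cases "p = {}")
  case True
  show thesis
  proof (rule that[of V G])
    show "openin tau_p G" using openin_topspace[of tau_p] by simp
  qed (use assms True id_in_Aut in auto)
next
  case False
  have pK: "p \<in> K" using assms openin_subset[OF assms(1)] by auto
  obtain l where l: "{..l} \<subset> p" "\<And>q. q \<in> K \<Longrightarrow> {..l} \<subset> q \<Longrightarrow> q \<subseteq> p \<Longrightarrow> q \<in> V"
    using openin_cm_left[OF assms False] by metis
  obtain m where m: "{..l} \<subset> {..m}" "{..m} \<subset> p" using K_dense[of "{..l}" p] l(1) pK by auto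
  show thesis
  proof (rule that[of "{q \<in> K. {..m} \<subset> q}" "{u \<in> G. u m \<in> {l<..}}"])
    show "openin tau_p {u \<in> G. u m \<in> {l<..}}" by (rule openin_tau_p_eval) simp
    show "id \<in> {u \<in> G. u m \<in> {l<..}}" using m(1) id_in_Aut by (simp add: atMost_psubset_atMost)
    fix q u assume q: "q \<in> {q \<in> K. {..m} \<subset> q}" and u: "u \<in> {u \<in> G. u m \<in> {l<..}}"
      and sub: "u ` q \<subseteq> p"
    have uG: "u \<in> G" and "{..l} \<subset> {..u m}" using u by (auto simp: atMost_psubset_atMost)
    moreover have "{..u m} \<subset> u ` q"
      using q Aut_image_psubset[OF uG, of "{..m}" q] by (simp add: Aut_image_atMost[OF uG])
    ultimately have "{..l} \<subset> u ` q" by (metis order_less_trans)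
    then show "u ` q \<in> V" using l(2)[OF Aut_image_cmX[OF uG]] q sub by blast
  qed (use m(2) pK openin_cm_greater[of "{..m}"] in simp_all)
qed

lemma action_right:
  assumes "openin cm_top V" "p \<in> V"
  obtains I U where "openin cm_top I" "p \<in> I" "openin tau_p U" "id \<in> U"
    "\<And>q u. q \<in> I \<Longrightarrow> u \<in> U \<Longrightarrow> p \<subseteq> u ` q \<Longrightarrow> u ` q \<in> (V :: 'a set set)"
proof (cases "p = UNIV")
  case True
  show thesis
  proof (rule that[of V G])
    show "openin tau_p G" using openin_topspace[of tau_p] by simp
    show "u ` q \<in> V" if "p \<subseteq> u ` q" for q u
      using that True assms by (metis top.extremum_uniqueI)
  qed (use assms True id_in_Aut in auto)
next
  case False
  have pK: "p \<in> K" using assms openin_subset[OF assms(1)] by auto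
  obtain r where r: "p \<subset> {..r}" "\<And>q. q \<in> K \<Longrightarrow> q \<subset> {..r} \<Longrightarrow> p \<subseteq> q \<Longrightarrow> q \<in> V"
    using openin_cm_right[OF assms False] by metis
  obtain m where m: "p \<subset> {..m}" "{..m} \<subset> {..r}" using K_dense[of p "{..r}"] r(1) pK by auto
  show thesis
  proof (rule that[of "{q \<in> K. q \<subset> {..m}}" "{u \<in> G. u m \<in> {..<r}}"])
    show "openin tau_p {u \<in> G. u m \<in> {..<r}}" by (rule openin_tau_p_eval) simp
    show "id \<in> {u \<in> G. u m \<in> {..<r}}" using m(2) id_in_Aut by (simp add: atMost_psubset_atMost)
    fix q u assume q: "q \<in> {q \<in> K. q \<subset> {..m}}" and u: "u \<in> {u \<in> G. u m \<in> {..<r}}"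
      and sub: "p \<subseteq> u ` q"
    have uG: "u \<in> G" and "{..u m} \<subset> {..r}" using u by (auto simp: atMost_psubset_atMost)
    moreover have "u ` q \<subset> {..u m}"
      using q Aut_image_psubset[OF uG, of q "{..m}"] by (simp add: Aut_image_atMost[OF uG])
    ultimately have "u ` q \<subset> {..r}" by (metis order_less_trans)
    then show "u ` q \<in> V" using r(2)[OF Aut_image_cmX[OF uG]] q sub by blast
  qed (use m(1) pK openin_cm_less[of "{..m}"] in simp_all)
qed

lemma action_continuous_at_id:
  assumes "openin cm_top V" "p \<in> (V :: 'a set set)"
  obtains I U where "openin cm_top I" "p \<in> I" "openin tau_p U" "id \<in> U"
    "\<And>q u. q \<in> I \<Longrightarrow> u \<in> U \<Longrightarrow> u ` q \<in> V"
proof -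
  have pK: "p \<in> K" using assms openin_subset[OF assms(1)] by auto
  obtain I U where IU: "openin cm_top I" "p \<in> I" "openin tau_p U" "id \<in> U"
    "\<And>q u. q \<in> I \<Longrightarrow> u \<in> U \<Longrightarrow> u ` q \<subseteq> p \<Longrightarrow> u ` q \<in> V"
    using action_left[OF assms] by metis
  obtain J T where JT: "openin cm_top J" "p \<in> J" "openin tau_p T" "id \<in> T"
    "\<And>q u. q \<in> J \<Longrightarrow> u \<in> T \<Longrightarrow> p \<subseteq> u ` q \<Longrightarrow> u ` q \<in> V"
    using action_right[OF assms] by metis
  show thesis
  proof (rule that[of "I \<inter> J" "U \<inter> T"])
    fix q u assume *: "q \<in> I \<inter> J" "u \<in> U \<inter> T"
    then have "q \<in> K" "u \<in> G"
      using openin_subset[OF IU(1)] openin_subset[OF IU(3)] by auto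
    then have "u ` q \<subseteq> p \<or> p \<subseteq> u ` q" using cmX_linear[OF Aut_image_cmX pK] by metis
    then show "u ` q \<in> V" using IU(5)[of q u] JT(5)[of q u] * by auto
  qed (use IU JT in auto)
qed

text \<open>Continuity at (id, p) yields one neighbourhood of the identity that works for all points
  close to p. The property \<open>good\<close> passes to subsets and to unions of two sets, so it
  can be propagated from such local pieces to all of c_m X.\<close>

lemma uniformly_small_at_id:
  assumes W: "openin (prod_topology cm_top cm_top) W" and diag: "\<And>z. z \<in> K \<Longrightarrow> (z, z) \<in> W"
  obtains U where "openin tau_p U" "id \<in> U"
    "\<And>y u v. y \<in> K \<Longrightarrow> u \<in> U \<Longrightarrow> v \<in> U \<Longrightarrow> (u ` y, v ` y) \<in> W"
proof -
  define good where "good A \<longleftrightarrow> (\<exists>U. openin tau_p U \<and> id \<in> U \<and> (\<forall>y\<in>A. \<forall>u\<in>U. \<forall>v\<in>U. (u ` y, v ` y) \<in> W))"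
    for A :: "'a set set"
  have good_subset: "good A" if "good B" "A \<subseteq> B" for A B
    using that unfolding good_def by (meson subsetD)
  have good_Un: "good (A \<union> B)" if A: "good A" and B: "good B" for A B
  proof -
    obtain U where U: "openin tau_p U" "id \<in> U" "\<forall>y\<in>A. \<forall>u\<in>U. \<forall>v\<in>U. (u ` y, v ` y) \<in> W"
      using A unfolding good_def by auto
    obtain V where V: "openin tau_p V" "id \<in> V" "\<forall>y\<in>B. \<forall>u\<in>V. \<forall>v\<in>V. (u ` y, v ` y) \<in> W"
      using B unfolding good_def by auto
    show ?thesis unfolding good_def
      by (rule exI[of _ "U \<inter> V"]) (use U V in auto)
  qed
  have local: "\<exists>I. openin cm_top I \<and> p \<in> I \<and> good I" if p: "p \<in> K" for p
  proof -
    obtain V1 V2 where V: "openin cm_top V1" "openin cm_top V2" "p \<in> V1" "p \<in> V2" "V1 \<times> V2 \<subseteq> W"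
      using W diag[OF p] unfolding openin_prod_topology_alt by metis
    have V12: "openin cm_top (V1 \<inter> V2)" "p \<in> V1 \<inter> V2" using V by auto
    obtain I U where IU: "openin cm_top I" "p \<in> I" "openin tau_p U" "id \<in> U"
      "\<And>q u. q \<in> I \<Longrightarrow> u \<in> U \<Longrightarrow> u ` q \<in> V1 \<inter> V2"
      using action_continuous_at_id[OF V12] by metis
    have "(u ` y, v ` y) \<in> W" if "y \<in> I" "u \<in> U" "v \<in> U" for y u v
      using IU(5)[of y u] IU(5)[of y v] that V(5) by auto
    then show ?thesis using IU unfolding good_def by blast
  qed
  \<comment> \<open>Compactness is replaced by completeness of the order: the good initial segments reach \<open>sup\<close>.\<close>
  define Y where "Y = {y \<in> K. good {x \<in> K. x \<subseteq> y}}"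
  obtain s where s: "s \<in> K" "\<And>p. p \<in> Y \<Longrightarrow> p \<subseteq> s" "\<And>q. q \<in> K \<Longrightarrow> (\<And>p. p \<in> Y \<Longrightarrow> p \<subseteq> q) \<Longrightarrow> s \<subseteq> q"
    using K_sup[of Y] unfolding Y_def by blast
  obtain I where I: "openin cm_top I" "s \<in> I" "good I" using local[OF s(1)] by blast
  have "good {x \<in> K. x \<subseteq> s}"
  proof (cases "s = {}")
    case True
    then have "{x \<in> K. x \<subseteq> s} \<subseteq> I" using I(2) by auto
    then show ?thesis using good_subset[OF I(3)] by metis
  next
    case False
    obtain l where l: "{..l} \<subset> s" "\<And>q. q \<in> K \<Longrightarrow> {..l} \<subset> q \<Longrightarrow> q \<subseteq> s \<Longrightarrow> q \<in> I"
      using openin_cm_left[OF I(1,2) False] by metis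
    \<comment> \<open>\<open>{..l}\<close> is not an upper bound of \<open>Y\<close>, so some y in
      \<open>Y\<close> lies above it; the segment up to y together with \<open>I\<close> covers the
      segment up to s.\<close>
    have "\<not> s \<subseteq> {..l}" using l(1) by auto
    then obtain y where y: "y \<in> Y" "\<not> y \<subseteq> {..l}" using s(3)[of "{..l}"] by auto
    then have yK: "y \<in> K" and "good {x \<in> K. x \<subseteq> y}" and ly: "{..l} \<subset> y"
      using cmX_not_subset[of y "{..l}"] unfolding Y_def by auto
    then have "good ({x \<in> K. x \<subseteq> y} \<union> I)" using good_Un I(3) by blast
    moreover have "x \<in> {x \<in> K. x \<subseteq> y} \<union> I" if "x \<in> K" "x \<subseteq> s" for x
    proof (cases "x \<subseteq> y")
      case False
      then have "y \<subset> x" using cmX_not_subset that(1) yK by metis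
      then show ?thesis using l(2)[OF that(1) _ that(2)] ly by (metis UnI2 order_less_trans)
    qed (use that in auto)
    ultimately show ?thesis using good_subset by (metis (no_types, lifting) mem_Collect_eq subsetI)
  qed
  moreover have "s = UNIV"
  proof (rule ccontr)
    \<comment> \<open>If s were below sup, \<open>I\<close> would reach past s to some t, and the
      segment up to t would be good, against s being an upper bound of \<open>Y\<close>.\<close>
    assume "s \<noteq> UNIV"
    then obtain r where r: "s \<subset> {..r}" "\<And>q. q \<in> K \<Longrightarrow> q \<subset> {..r} \<Longrightarrow> s \<subseteq> q \<Longrightarrow> q \<in> I"
      using openin_cm_right[OF I(1,2)] by metis
    obtain t where t: "s \<subset> {..t}" "{..t} \<subset> {..r}" using K_dense[of s "{..r}"] s(1) r(1) by auto
    have "good ({x \<in> K. x \<subseteq> s} \<union> I)" using good_Un I(3) \<open>good {x \<in> K. x \<subseteq> s}\<close> by blast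
    moreover have "x \<in> {x \<in> K. x \<subseteq> s} \<union> I" if "x \<in> K" "x \<subseteq> {..t}" for x
    proof (cases "x \<subseteq> s")
      case False
      then have "s \<subseteq> x" using cmX_linear that(1) s(1) by metis
      then show ?thesis using r(2)[OF that(1)] that(2) t(2) by (metis UnI2 order_le_less_trans)
    qed (use that in auto)
    ultimately have "good {x \<in> K. x \<subseteq> {..t}}"
      using good_subset by (metis (no_types, lifting) mem_Collect_eq subsetI)
    then have "{..t} \<subseteq> s" using s(2) unfolding Y_def by auto
    then show False using t(1) by auto
  qed
  ultimately have "good K" by simp
  then obtain U where U: "openin tau_p U" "id \<in> U" "\<forall>y\<in>K. \<forall>u\<in>U. \<forall>v\<in>U. (u ` y, v ` y) \<in> W"
    unfolding good_def by auto
  show thesis by (rule that[OF U(1,2)]) (simp add: U(3))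
qed

section \<open>First inclusion between the two uniformities\<close>

text \<open>Elements u g s and v g t of one double coset send z in \<sigma> to u (g z) and v (g z),
  which are \<open>W\<close>-close because \<open>U\<close> moves all points of c_m X uniformly
  little.\<close>

lemma V_G_subset_R_Sigma: "V_G G \<subseteq> R_Sigma G tau_p cm_act K"
proof
  fix E assume "E \<in> V_G G"
  then obtain \<sigma> W where E: "E \<subseteq> G \<times> G" and \<sigma>: "finite \<sigma>" "\<sigma> \<subseteq> K"
    and W: "openin (prod_topology cm_top cm_top) W" "\<forall>z\<in>K. (z, z) \<in> W"
    and sub: "{(g, h). g \<in> G \<and> h \<in> G \<and> (\<forall>z\<in>\<sigma>. (cm_act g z, cm_act h z) \<in> W)} \<subseteq> E"
    unfolding V_G_def by auto
  obtain U where U: "openin tau_p U" "id \<in> U"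
    "\<And>y u v. y \<in> K \<Longrightarrow> u \<in> U \<Longrightarrow> v \<in> U \<Longrightarrow> (u ` y, v ` y) \<in> W"
    using uniformly_small_at_id[OF W(1)] W(2) by metis
  \<comment> \<open>Base covers require a nonempty finite set; \<open>{}\<close> is fixed by every
    automorphism, so adjoining it leaves the stabiliser unchanged.\<close>
  let ?S = "Stab G cm_act (insert {} \<sigma>)"
  have "(a, b) \<in> E" if g: "g \<in> G" and a: "a \<in> dcoset U g ?S" and b: "b \<in> dcoset U g ?S" for g a b
  proof -
    obtain u s where u: "a = u \<circ> g \<circ> s" "u \<in> U" "s \<in> ?S" using a unfolding dcoset_def by auto
    obtain v t where v: "b = v \<circ> g \<circ> t" "v \<in> U" "t \<in> ?S" using b unfolding dcoset_def by auto
    have UG: "U \<subseteq> G" using openin_subset[OF U(1)] by simp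
    have "a \<in> G" "b \<in> G" using u v UG g by (auto simp: Stab_def intro!: comp_in_Aut)
    moreover have "(cm_act a z, cm_act b z) \<in> W" if "z \<in> \<sigma>" for z
    proof -
      have "s ` z = z" "t ` z = z" using u(3) v(3) that by (auto simp: Stab_def cm_act_def)
      moreover have "a ` z = u ` (g ` (s ` z))" "b ` z = v ` (g ` (t ` z))"
        by (simp_all add: u(1) v(1) image_image)
      ultimately have "a ` z = u ` (g ` z)" "b ` z = v ` (g ` z)" by simp_all
      then show ?thesis
        using U(3)[OF Aut_image_cmX[OF g] u(2) v(2)] \<sigma>(2) that by (auto simp: cm_act_def)
    qed
    ultimately show ?thesis using sub by blast
  qed
  then have "\<forall>g\<in>G. dcoset U g ?S \<times> dcoset U g ?S \<subseteq> E" by (auto simp: subset_iff)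
  then show "E \<in> R_Sigma G tau_p cm_act K"
    unfolding mem_R_Sigma_iff using E U(1,2) \<sigma>
    by (intro conjI exI[of _ U] exI[of _ "insert {} \<sigma>"]) auto
qed

section \<open>Boxes around the identity\<close>

text \<open>Basic neighbourhoods are shrunk to disjoint open intervals around finitely many points,
  ordered like their centres. Any values picked from them form a strictly increasing map on S, ready
  to be extended to an automorphism.\<close>

lemma tau_p_nhd_id:
  assumes "openin tau_p U" "id \<in> U"
  obtains S and a b :: "'a \<Rightarrow> 'a" where "finite S" "S \<noteq> {}" "\<And>x. x \<in> S \<Longrightarrow> a x < x \<and> x < b x"
    "\<And>x y. x \<in> S \<Longrightarrow> y \<in> S \<Longrightarrow> x < y \<Longrightarrow> b x < a y"
    "\<And>u. u \<in> G \<Longrightarrow> (\<And>x. x \<in> S \<Longrightarrow> a x < u x \<and> u x < b x) \<Longrightarrow> u \<in> U"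
proof -
  obtain T where T: "openin (product_topology (\<lambda>_ :: 'a. euclidean) UNIV) T" "U = T \<inter> Aut"
    using assms(1) unfolding tau_p_def openin_subtopology by auto
  have "id \<in> T" using assms(2) T(2) by simp
  then obtain V where V: "finite {i. V i \<noteq> UNIV}" "\<And>i. open (V i)" "id \<in> Pi\<^sub>E UNIV V" "Pi\<^sub>E UNIV V \<subseteq> T"
    using T(1) unfolding openin_product_topology_alt by (auto simp: open_openin[symmetric])
  have xV: "x \<in> V x" for x using V(3) by (auto simp: PiE_iff)
  have "\<exists>a b. a < x \<and> x < b \<and> {a<..<b} \<subseteq> V x" for x
  proof -
    obtain l r where "l < x" "x < r" using lt_ex gt_ex by blast
    then obtain a b where ab: "a < x" "{a<..x} \<subseteq> V x" "x < b" "{x..<b} \<subseteq> V x"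
      using open_left[OF V(2) xV] open_right[OF V(2) xV] by metis
    have "{a<..<b} \<subseteq> {a<..x} \<union> {x..<b}" by auto
    then show ?thesis using ab by blast
  qed
  then obtain a0 b0 where ab0: "\<And>x. a0 x < x" "\<And>x. x < b0 x" "\<And>x. {a0 x<..<b0 x} \<subseteq> V x"
    by metis
  \<comment> \<open>\<open>undefined\<close> serves to make S nonempty; the set \<open>V\<close> may
    be all of X there.\<close>
  define S where "S = insert undefined {i. V i \<noteq> UNIV}"
  have S: "finite S" "S \<noteq> {}" "\<And>x. x \<notin> S \<Longrightarrow> V x = UNIV" using V(1) by (auto simp: S_def)
  \<comment> \<open>The left ends are chosen first, each above all smaller points of S; the right
    ends can then be placed below the left ends of all larger points.\<close>
  have "\<exists>y. (\<forall>z\<in>insert (a0 x) {s\<in>S. s < x}. z < y) \<and> (\<forall>z\<in>{x}. y < z)" for x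
    by (rule between_finite) (use S ab0 in auto)
  then obtain a where a: "\<And>x. a0 x < a x" "\<And>x s. s \<in> S \<Longrightarrow> s < x \<Longrightarrow> s < a x" "\<And>x. a x < x"
    by (metis (no_types, lifting) insertI1 insertI2 mem_Collect_eq)
  have bet: "\<exists>y. (\<forall>z\<in>{x}. z < y) \<and> (\<forall>z\<in>insert (b0 x) (a ` {s\<in>S. x < s}). y < z)" if "x \<in> S" for x
    by (rule between_finite) (use S ab0 a(2)[OF that] in auto)
  have "\<exists>y. x \<in> S \<longrightarrow> x < y \<and> y < b0 x \<and> (\<forall>s\<in>S. x < s \<longrightarrow> y < a s)" for x
  proof (cases "x \<in> S")
    case True
    then obtain y where "x < y" "\<forall>z\<in>insert (b0 x) (a ` {s\<in>S. x < s}). y < z"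
      using bet[OF True] by auto
    then show ?thesis by auto
  qed simp
  then obtain b where b: "\<And>x. x \<in> S \<Longrightarrow> x < b x \<and> b x < b0 x \<and> (\<forall>s\<in>S. x < s \<longrightarrow> b x < a s)"
    by metis
  show thesis
  proof (rule that[of S a b])
    fix u assume u: "u \<in> G" "\<And>x. x \<in> S \<Longrightarrow> a x < u x \<and> u x < b x"
    have "u x \<in> V x" for x
    proof (cases "x \<in> S")
      case True
      then have "a0 x < u x" "u x < b0 x" using u(2)[OF True] a(1)[of x] b[OF True] by auto
      then show ?thesis using ab0(3)[of x] by auto
    qed (simp add: S(3))
    then show "u \<in> U" using V(4) T(2) u(1) by (auto simp: PiE_iff)
  qed (use S a b in simp_all)
qed

text \<open>Automorphisms fixing the centres of the boxes stay inside them. The stabiliser need not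
  itself be open, as X carries its order topology.\<close>

lemma Stab_subset_nhd_id:
  assumes "openin tau_p U" "id \<in> U"
  obtains S :: "'a set" where "finite S" "S \<noteq> {}" "Stab G (\<lambda>g. g) S \<subseteq> U"
proof -
  obtain S and a b :: "'a \<Rightarrow> 'a" where S: "finite S" "S \<noteq> {}" "\<And>x. x \<in> S \<Longrightarrow> a x < x \<and> x < b x"
    "\<And>u. u \<in> G \<Longrightarrow> (\<And>x. x \<in> S \<Longrightarrow> a x < u x \<and> u x < b x) \<Longrightarrow> u \<in> U"
    by (rule tau_p_nhd_id[OF assms]) blast
  show thesis
    by (rule that[OF S(1,2)]) (use S(3,4) in \<open>auto simp: Stab_def\<close>)
qed

lemma Stab_atMost: "Stab G cm_act (atMost ` S) = Stab G (\<lambda>g. g) (S :: 'a set)"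
  unfolding Stab_def cm_act_def by (rule Collect_cong) (auto simp del: image_subset_iff simp: Aut_image_atMost cong: conj_cong)

section \<open>Limits of automorphisms are monotone\<close>

text \<open>A violation of monotonicity or of an endpoint condition would give an open condition on
  at most two coordinates of f. Some automorphism would then satisfy it as well, which is
  impossible.\<close>

lemma ellis_imp_monotone:
  assumes "f \<in> (ellis_cm :: ('a set \<Rightarrow> 'a set) set)"
  shows "f \<in> extensional K" "\<And>z. z \<in> K \<Longrightarrow> f z \<in> K"
    and "\<And>x y. x \<in> K \<Longrightarrow> y \<in> K \<Longrightarrow> x \<subset> y \<Longrightarrow> f x \<subseteq> f y" "f {} = {}" "f UNIV = UNIV"
proof -
  let ?P = "product_topology (\<lambda>_. cm_top) K"
  have "f \<in> topspace ?P" by (rule subsetD[OF closure_of_subset_topspace assms[unfolded ellis_cm_def]])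
  then have f: "f \<in> K \<rightarrow>\<^sub>E K" by simp
  then show "f \<in> extensional K" and fK: "\<And>z. z \<in> K \<Longrightarrow> f z \<in> K" by (auto simp: PiE_iff)
  have approx: "\<exists>g\<in>G. g ` x \<in> V \<and> g ` y \<in> V'"
    if "x \<in> K" "y \<in> K" "openin cm_top V" "openin cm_top V'" "f x \<in> V" "f y \<in> V'" for x y V V'
  proof -
    have "openin ?P {h \<in> topspace ?P. h z \<in> V}" if "z \<in> K" "openin cm_top V" for z V
      by (rule openin_continuous_map_preimage[OF continuous_map_product_projection[OF that(1)] that(2)])
    then have "openin ?P ({h \<in> topspace ?P. h x \<in> V} \<inter> {h \<in> topspace ?P. h y \<in> V'})"
      using that by (intro openin_Int)
    moreover have "f \<in> {h \<in> topspace ?P. h x \<in> V} \<inter> {h \<in> topspace ?P. h y \<in> V'}" using f that by simp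
    ultimately have "\<exists>h. h \<in> iota_cm ` G \<and> h \<in> {h \<in> topspace ?P. h x \<in> V} \<inter> {h \<in> topspace ?P. h y \<in> V'}"
      by (intro assms[unfolded ellis_cm_def in_closure_of, THEN conjunct2, rule_format] conjI)
    then obtain g where "g \<in> G" "iota_cm g x \<in> V" "iota_cm g y \<in> V'" by auto
    then show ?thesis using that(1,2) by (auto simp: iota_cm_def cm_act_def)
  qed
  have mono: "f x \<subseteq> f y" if xy: "x \<in> K" "y \<in> K" "x \<subseteq> y" for x y
  proof (rule ccontr)
    assume "\<not> f x \<subseteq> f y"
    then have "f y \<subset> f x" using cmX_not_subset fK xy by metis
    \<comment> \<open>A point c of X strictly between f y and f x makes the violation open: g y < c
      < g x contradicts x \<le> y.\<close>
    then obtain c where c: "f y \<subset> {..c}" "{..c} \<subset> f x" by (rule K_dense[OF fK[OF xy(2)] fK[OF xy(1)]])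
    obtain g where g: "g \<in> G" "g ` x \<in> {p \<in> K. {..c} \<subset> p}" "g ` y \<in> {p \<in> K. p \<subset> {..c}}"
      using approx[OF xy(1,2) openin_cm_greater[of "{..c}"] openin_cm_less[of "{..c}"]] c fK xy by auto
    have "g ` y \<subset> g ` x" using g(2,3) order_less_trans[of "g ` y" "{..c}" "g ` x"] by simp
    then show False using image_mono[OF xy(3), of g] by (metis leD)
  qed
  then show "\<And>x y. x \<in> K \<Longrightarrow> y \<in> K \<Longrightarrow> x \<subset> y \<Longrightarrow> f x \<subseteq> f y" by blast
  show "f {} = {}"
  proof (rule ccontr)
    assume "f {} \<noteq> {}"
    then obtain g where "g \<in> G" "g ` {} \<in> {p \<in> K. {} \<subset> p}"
      using approx[of "{}" "{}", OF _ _ openin_cm_greater[of "{}"] openin_cm_greater[of "{}"]] fK by auto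
    then show False by simp
  qed
  show "f UNIV = UNIV"
  proof (rule ccontr)
    assume "f UNIV \<noteq> UNIV"
    then obtain g where "g \<in> G" "g ` UNIV \<in> {p \<in> K. p \<subset> UNIV}"
      using approx[of UNIV UNIV, OF _ _ openin_cm_less[of UNIV] openin_cm_less[of UNIV]] fK by auto
    then show False using Aut_surj by blast
  qed
qed

section \<open>Strictly increasing points above monotone values\<close>

text \<open>F may take equal values at different cuts, while an automorphism needs strictly
  increasing targets; the slack between F p and r p provides the room to separate them.\<close>

lemma strict_mono_selection:
  fixes F :: "'a set \<Rightarrow> 'a set" and r :: "'a set \<Rightarrow> 'a"
  assumes "finite \<sigma>" "\<sigma> \<subseteq> K" "\<And>p. p \<in> \<sigma> \<Longrightarrow> F p \<in> K" "\<And>p. p \<in> \<sigma> \<Longrightarrow> F p \<subset> {..r p}"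
    "\<And>p q. p \<in> \<sigma> \<Longrightarrow> q \<in> \<sigma> \<Longrightarrow> p \<subset> q \<Longrightarrow> F p \<subseteq> F q"
  shows "\<exists>y. (\<forall>p\<in>\<sigma>. F p \<subset> {..y p} \<and> y p < r p) \<and> (\<forall>p\<in>\<sigma>. \<forall>q\<in>\<sigma>. p \<subset> q \<longrightarrow> y p < y q)"
proof -
  \<comment> \<open>With monotone upper bounds the cuts can be treated in any order.\<close>
  define \<rho> where "\<rho> p = Min (r ` {q \<in> \<sigma>. p \<subseteq> q})" for p
  have \<rho>_le: "\<rho> p \<le> r p" if "p \<in> \<sigma>" for p
    unfolding \<rho>_def using assms(1) that by (intro Min_le) auto
  have \<rho>_mono: "\<rho> p \<le> \<rho> q" if "p \<in> \<sigma>" "q \<in> \<sigma>" "p \<subset> q" for p q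
    unfolding \<rho>_def using assms(1) that by (intro Min_antimono) auto
  have F\<rho>: "F p \<subset> {..\<rho> p}" if "p \<in> \<sigma>" for p
  proof -
    have "\<rho> p \<in> r ` {q \<in> \<sigma>. p \<subseteq> q}" unfolding \<rho>_def using assms(1) that by (intro Min_in) auto
    then obtain q where q: "q \<in> \<sigma>" "p \<subseteq> q" "\<rho> p = r q" by blast
    have "F p \<subseteq> F q" using assms(5)[OF that q(1)] q(2) by (cases "p = q") auto
    then show ?thesis using assms(4)[OF q(1)] q(3) by (metis order_le_less_trans)
  qed
  have "\<exists>y. (\<forall>p\<in>\<tau>. F p \<subset> {..y p} \<and> y p < \<rho> p) \<and> (\<forall>p\<in>\<tau>. \<forall>q\<in>\<tau>. p \<subset> q \<longrightarrow> y p < y q)" if "\<tau> \<subseteq> \<sigma>" for \<tau>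
    using finite_subset[OF that assms(1)] that
  proof (induction rule: finite_subset_induct')
    case empty
    show ?case by simp
  next
    case (insert p \<tau>)
    obtain y where y [rule_format]: "\<forall>q\<in>\<tau>. F q \<subset> {..y q} \<and> y q < \<rho> q"
      "\<forall>q\<in>\<tau>. \<forall>q'\<in>\<tau>. q \<subset> q' \<longrightarrow> y q < y q'"
      using insert.IH by (elim exE conjE)
    have \<tau>: "q \<in> \<sigma>" if "q \<in> \<tau>" for q using insert.hyps(3) that by (rule subsetD)
    have p: "p \<in> \<sigma>" by (rule insert.hyps(2))
    \<comment> \<open>The new point must exceed F p and the points of smaller cuts, and stay below
      \<rho> p and the points of larger cuts; monotonicity of F and \<rho> makes these demands
      compatible.\<close>
    let ?A = "insert (F p) ((\<lambda>q. {..y q}) ` {q \<in> \<tau>. q \<subset> p})"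
    let ?B = "insert {..\<rho> p} ((\<lambda>q. {..y q}) ` {q \<in> \<tau>. p \<subset> q})"
    have "\<exists>c. (\<forall>a\<in>?A. a \<subset> {..c}) \<and> (\<forall>b\<in>?B. {..c} \<subset> b)"
    proof (rule K_between_finite)
      have 1: "{..y q} \<subset> {..\<rho> p}" if "q \<in> \<tau>" "q \<subset> p" for q
        using y(1)[THEN conjunct2, OF that(1)] \<rho>_mono[OF \<tau>[OF that(1)] p that(2)] by (simp add: atMost_psubset_atMost)
      have 2: "F p \<subset> {..y q}" if "q \<in> \<tau>" "p \<subset> q" for q
        using y(1)[THEN conjunct1, OF that(1)] assms(5)[OF p \<tau>[OF that(1)] that(2)] by (rule order_le_less_trans[rotated])
      have 3: "{..y q} \<subset> {..y q'}" if "q \<in> \<tau>" "q' \<in> \<tau>" "q \<subset> p" "p \<subset> q'" for q q'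
        using y(2)[OF that(1,2)] order_less_trans[OF that(3,4)] by (simp add: atMost_psubset_atMost)
      show "\<forall>a\<in>?A. \<forall>b\<in>?B. a \<subset> b"
        by (intro ballI, elim insertE imageE CollectE conjE) (simp_all only: F\<rho>[OF p] 1 2 3)
      show "UNIV \<notin> ?A" using atMost_neq(2) F\<rho>[OF p] by auto
      show "{} \<notin> ?B" using atMost_neq(1) by auto
    qed (use insert.hyps(1) assms(3)[OF p] in auto)
    then obtain c where c [rule_format]: "\<forall>a\<in>?A. a \<subset> {..c}" "\<forall>b\<in>?B. {..c} \<subset> b"
      by (elim exE conjE)
    have c1: "F p \<subset> {..c}" "c < \<rho> p" using c(1)[of "F p"] c(2)[of "{..\<rho> p}"] by (simp_all add: atMost_psubset_atMost)
    have c2: "y q < c" if "q \<in> \<tau>" "q \<subset> p" for q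
      using c(1)[of "{..y q}"] that by (simp add: atMost_psubset_atMost)
    have c3: "c < y q" if "q \<in> \<tau>" "p \<subset> q" for q
      using c(2)[of "{..y q}"] that by (simp add: atMost_psubset_atMost)
    have "F q \<subset> {..(y(p := c)) q} \<and> (y(p := c)) q < \<rho> q" if "q \<in> insert p \<tau>" for q
      using that c1 y(1) by (cases "q = p") simp_all
    moreover have "(y(p := c)) q < (y(p := c)) q'" if "q \<in> insert p \<tau>" "q' \<in> insert p \<tau>" "q \<subset> q'" for q q'
      using that c2 c3 y(2) by (cases "q = p"; cases "q' = p") simp_all
    ultimately show ?case by (intro exI[of _ "y(p := c)"] conjI ballI impI) simp_all
  qed
  from this[OF order_refl] obtain y where y: "\<forall>p\<in>\<sigma>. F p \<subset> {..y p} \<and> y p < \<rho> p"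
    "\<forall>p\<in>\<sigma>. \<forall>q\<in>\<sigma>. p \<subset> q \<longrightarrow> y p < y q"
    by (elim exE conjE)
  have "F p \<subset> {..y p} \<and> y p < r p" if "p \<in> \<sigma>" for p
    using y(1)[rule_format, OF that] \<rho>_le[OF that] by (blast intro: order_less_le_trans)
  then show ?thesis using y(2) by (intro exI[of _ y]) simp
qed

text \<open>A cut may be a gap, so its image is controlled by an interval rather than a point. The
  right ends come from \<open>strict_mono_selection\<close>; each left end is then put above F p and
  the right ends of all smaller cuts.\<close>

lemma strict_mono_interval_selection:
  fixes F :: "'a set \<Rightarrow> 'a set" and r :: "'a set \<Rightarrow> 'a"
  assumes "finite \<sigma>" "\<sigma> \<subseteq> K" "\<And>p. p \<in> \<sigma> \<Longrightarrow> F p \<in> K" "\<And>p. p \<in> \<sigma> \<Longrightarrow> F p \<subset> {..r p}"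
    "\<And>p q. p \<in> \<sigma> \<Longrightarrow> q \<in> \<sigma> \<Longrightarrow> p \<subset> q \<Longrightarrow> F p \<subseteq> F q"
  shows "\<exists>a b. (\<forall>p\<in>\<sigma>. F p \<subset> {..a p} \<and> a p < b p \<and> b p < r p) \<and> (\<forall>p\<in>\<sigma>. \<forall>q\<in>\<sigma>. p \<subset> q \<longrightarrow> b p < a q)"
proof -
  have "\<exists>y. (\<forall>p\<in>\<sigma>. F p \<subset> {..y p} \<and> y p < r p) \<and> (\<forall>p\<in>\<sigma>. \<forall>q\<in>\<sigma>. p \<subset> q \<longrightarrow> y p < y q)"
    by (rule strict_mono_selection) (simp_all add: assms)
  then obtain b where b [rule_format]: "\<forall>p\<in>\<sigma>. F p \<subset> {..b p} \<and> b p < r p"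
    "\<forall>p\<in>\<sigma>. \<forall>q\<in>\<sigma>. p \<subset> q \<longrightarrow> b p < b q"
    by (elim exE conjE)
  have "\<exists>c. p \<in> \<sigma> \<longrightarrow> F p \<subset> {..c} \<and> c < b p \<and> (\<forall>q\<in>\<sigma>. q \<subset> p \<longrightarrow> b q < c)" for p
  proof (cases "p \<in> \<sigma>")
    case True
    let ?A = "insert (F p) ((\<lambda>q. {..b q}) ` {q \<in> \<sigma>. q \<subset> p})"
    have "\<exists>c. (\<forall>x\<in>?A. x \<subset> {..c}) \<and> (\<forall>x\<in>{{..b p}}. {..c} \<subset> x)"
    proof (rule K_between_finite)
      show "\<forall>x\<in>?A. \<forall>z\<in>{{..b p}}. x \<subset> z"
        using b(1)[OF True] b(2)[OF _ True] by (simp add: atMost_psubset_atMost)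
      show "UNIV \<notin> ?A" using atMost_neq(2) b(1)[OF True] by auto
    qed (use assms(1,3) True atMost_neq(1) in auto)
    then show ?thesis by (auto simp: atMost_psubset_atMost)
  qed simp
  then obtain a where "\<And>p. p \<in> \<sigma> \<Longrightarrow> F p \<subset> {..a p} \<and> a p < b p \<and> (\<forall>q\<in>\<sigma>. q \<subset> p \<longrightarrow> b q < a p)"
    by metis
  then show ?thesis using b(1) by (intro exI[of _ a] exI[of _ b]) simp
qed

section \<open>Continuously ordered chains\<close>

lemma continuously_ordered_cmX:
  assumes "continuously_ordered TYPE('a)" shows "K = range atMost \<union> {{}, UNIV :: 'a set}"
  using assms by (auto simp: continuously_ordered_def cmX_def)

text \<open>c_m X then adds only inf and sup, which every automorphism fixes, so finite sets of cuts
  and finite subsets of X yield the same stabilisers up to shrinking.\<close>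

lemma R_Sigma_continuously_ordered:
  assumes co: "continuously_ordered TYPE('a)"
  shows "R_Sigma G tau_p cm_act K = R_Sigma G tau_p (\<lambda>g. g) (UNIV :: 'a set)"
proof (intro set_eqI iffI)
  fix E assume "E \<in> R_Sigma G tau_p cm_act K"
  then obtain U \<sigma> where E: "E \<subseteq> G \<times> G" and U: "openin tau_p U" "id \<in> U"
    and \<sigma>: "finite \<sigma>" "\<sigma> \<subseteq> K"
    and sub: "\<forall>g\<in>G. dcoset U g (Stab G cm_act \<sigma>) \<times> dcoset U g (Stab G cm_act \<sigma>) \<subseteq> E"
    unfolding mem_R_Sigma_iff by blast
  \<comment> \<open>\<open>undefined\<close> keeps \<open>T\<close> nonempty when \<sigma> consists
    of inf or sup only; fixing one more point merely shrinks the stabiliser.\<close>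
  define T where "T = insert undefined (atMost -` \<sigma> :: 'a set)"
  have "finite T" unfolding T_def using \<sigma>(1) by (simp add: finite_vimageI inj_on_def)
  have "Stab G (\<lambda>g. g) T \<subseteq> Stab G cm_act \<sigma>"
  proof
    fix g assume "g \<in> Stab G (\<lambda>g. g) T"
    then have g: "g \<in> G" "\<And>t. {..t} \<in> \<sigma> \<Longrightarrow> g t = t" by (auto simp: Stab_def T_def)
    have "g ` z = z" if "z \<in> \<sigma>" for z
    proof -
      have "z \<in> range atMost \<union> {{}, UNIV}" using that \<sigma>(2) continuously_ordered_cmX[OF co] by auto
      then consider t where "z = {..t}" | "z = {}" | "z = UNIV" by auto
      then show ?thesis
      proof cases
        case (1 t)
        then show ?thesis using g that by (simp add: Aut_image_atMost)
      qed (use Aut_surj[OF g(1)] in simp_all)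
    qed
    then show "g \<in> Stab G cm_act \<sigma>" using g(1) by (simp add: Stab_def cm_act_def)
  qed
  then have "dcoset U g (Stab G (\<lambda>g. g) T) \<subseteq> dcoset U g (Stab G cm_act \<sigma>)" for g
    unfolding dcoset_def by blast
  then have "\<forall>g\<in>G. dcoset U g (Stab G (\<lambda>g. g) T) \<times> dcoset U g (Stab G (\<lambda>g. g) T) \<subseteq> E"
    using sub by (meson Sigma_mono subset_trans)
  then show "E \<in> R_Sigma G tau_p (\<lambda>g. g) UNIV"
    unfolding mem_R_Sigma_iff using E U \<open>finite T\<close>
    by (intro conjI exI[of _ U] exI[of _ T]) (auto simp: T_def)
next
  fix E assume "E \<in> R_Sigma G tau_p (\<lambda>g. g) (UNIV :: 'a set)"
  then obtain U and S :: "'a set" where E: "E \<subseteq> G \<times> G" and U: "openin tau_p U" "id \<in> U"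
    and S: "finite S" "S \<noteq> {}"
    and sub: "\<forall>g\<in>G. dcoset U g (Stab G (\<lambda>g. g) S) \<times> dcoset U g (Stab G (\<lambda>g. g) S) \<subseteq> E"
    unfolding mem_R_Sigma_iff by blast
  then show "E \<in> R_Sigma G tau_p cm_act K"
    unfolding mem_R_Sigma_iff
    by (intro conjI exI[of _ U] exI[of _ "atMost ` S"]) (auto simp: Stab_atMost)
qed

end

section \<open>Ultrahomogeneous chains\<close>

locale ultrahomogeneous_chain =
  fixes type :: "'a :: linorder_topology itself"
  assumes infinite: "infinite (UNIV :: 'a set)"
    and ultrahomogeneous: "ultrahomogeneous TYPE('a)"
begin

section \<open>Extension of finite partial maps\<close>

text \<open>Listing S increasingly turns ultrahomogeneity, stated for lists, into the extension of
  strictly increasing maps on finite sets.\<close>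

lemma Aut_extends:
  fixes \<phi> :: "'a \<Rightarrow> 'a"
  assumes "finite S" "strict_mono_on S \<phi>"
  obtains g where "g \<in> Aut" "\<And>x. x \<in> S \<Longrightarrow> g x = \<phi> x"
proof -
  let ?xs = "sorted_list_of_set S"
  have "sorted_wrt (<) ?xs" using strict_sorted_list_of_set by blast
  moreover from this have "sorted_wrt (<) (map \<phi> ?xs)"
    unfolding sorted_wrt_map
    by (rule sorted_wrt_mono_rel[rotated]) (use assms in \<open>auto simp: strict_mono_on_def\<close>)
  ultimately obtain g where g: "g \<in> Aut" "\<forall>k<length ?xs. g (?xs ! k) = map \<phi> ?xs ! k"
    using ultrahomogeneous unfolding ultrahomogeneous_def by (metis length_map)
  show thesis
  proof (rule that[OF g(1)])
    fix x assume "x \<in> S"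
    then obtain k where "k < length ?xs" "x = ?xs ! k" using assms(1) by (metis in_set_conv_nth set_sorted_list_of_set)
    then show "g x = \<phi> x" using g(2) by simp
  qed
qed

lemma Aut_transitive: obtains g where "g \<in> Aut" "g x = (y :: 'a)"
  by (rule Aut_extends[of "{x}" "\<lambda>_. y"]) (auto simp: strict_mono_on_def)

lemma Aut_2_transitive:
  assumes "x < x'" "y < y'"
  obtains g where "g \<in> Aut" "g x = (y :: 'a)" "g x' = y'"
proof -
  have "strict_mono_on {x, x'} (\<lambda>z. if z = x then y else y')"
    using assms by (auto simp: strict_mono_on_def)
  then obtain g where g: "g \<in> Aut" "\<And>z. z \<in> {x, x'} \<Longrightarrow> g z = (if z = x then y else y')"
    using Aut_extends[of "{x, x'}"] by blast
  show thesis using that[OF g(1)] g(2)[of x] g(2)[of x'] less_imp_neq[OF assms(1)] by simp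
qed

text \<open>An automorphism taking a smaller point to a greatest element would send the latter above
  itself, and dually for a least one. For density, three points a < b < c exist, and moving a and c
  to x and y puts the image of b between them.\<close>

sublocale dense_chain
proof
  have ex: "\<exists>y. y \<noteq> x" for x :: 'a
    using infinite by (metis UNIV_eq_I finite.emptyI finite.insertI insert_iff)
  fix x y :: 'a
  show "\<exists>y. x < y"
  proof (rule ccontr)
    assume no: "\<nexists>y. x < y"
    then obtain y where "y < x" using ex by (meson neqE)
    obtain g where g: "g \<in> Aut" "g y = x" by (rule Aut_transitive)
    then have "x < g x" using \<open>y < x\<close> Aut_less_iff by metis
    then show False using no by blast
  qed
  show "\<exists>y. y < x"
  proof (rule ccontr)
    assume no: "\<nexists>y. y < x"
    then obtain y where "x < y" using ex by (meson neqE)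
    obtain g where g: "g \<in> Aut" "g y = x" by (rule Aut_transitive)
    then have "g x < x" using \<open>x < y\<close> Aut_less_iff by metis
    then show False using no by blast
  qed
  assume "x < y"
  obtain z where z: "z \<notin> {x, y}"
    using infinite by (metis UNIV_eq_I finite.emptyI finite.insertI)
  obtain a b c :: 'a where abc: "a < b" "b < c"
    using z \<open>x < y\<close> by (metis insertCI neqE)
  obtain g where g: "g \<in> Aut" "g a = x" "g c = y"
    by (rule Aut_2_transitive[of a c x y]) (use abc \<open>x < y\<close> in auto)
  then show "\<exists>z. x < z \<and> z < y" using abc Aut_less_iff by metis
qed

section \<open>Automorphisms fixing prescribed cuts\<close>

text \<open>Around each gap two points l and r of X are chosen so close that neither S nor its image
  meets the interval between them. An extension of \<phi> fixing these points is then replaced by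
  the identity on the intervals.\<close>

lemma Aut_fixing_cuts_gaps:
  fixes \<phi> :: "'a \<Rightarrow> 'a"
  assumes P: "finite P" "\<And>p. p \<in> P \<Longrightarrow> is_gap p" "{} \<notin> P" "UNIV \<notin> P"
    and S: "finite S" "strict_mono_on S \<phi>" "\<And>p x. p \<in> P \<Longrightarrow> x \<in> S \<Longrightarrow> \<phi> x \<in> p \<longleftrightarrow> x \<in> p"
  obtains w where "w \<in> G" "\<And>p. p \<in> P \<Longrightarrow> w ` p = p" "\<And>x. x \<in> S \<Longrightarrow> w x = \<phi> x"
proof -
  have down: "y \<in> p \<Longrightarrow> x \<le> y \<Longrightarrow> x \<in> p" if "p \<in> P" for p x y
    using P(2)[OF that] unfolding is_gap_def down_closed_def by blast
  define Z where "Z = S \<union> \<phi> ` S"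
  have Z: "finite Z" using S(1) by (simp add: Z_def)
  have "\<exists>l. l \<in> p \<and> (\<forall>x\<in>Z. x \<in> p \<longrightarrow> x < l)" if p: "p \<in> P" for p
  proof -
    obtain e where e: "e \<in> p" using P(3) p by (metis ex_in_conv)
    \<comment> \<open>A gap has no last element on its left, so something in p exceeds the finitely
      many relevant points; \<open>e\<close> covers the case that there are none.\<close>
    define m where "m = Max (insert e (Z \<inter> p))"
    have "m \<in> p" using Max_in[of "insert e (Z \<inter> p)"] e Z unfolding m_def by auto
    then obtain l where "l \<in> p" "m < l" using P(2)[OF p] unfolding is_gap_def by metis
    moreover have "x \<le> m" if "x \<in> Z" "x \<in> p" for x
      unfolding m_def by (rule Max_ge) (use Z that in auto)
    ultimately show ?thesis by (meson order_le_less_trans)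
  qed
  then obtain l where l: "\<And>p. p \<in> P \<Longrightarrow> l p \<in> p" "\<And>p x. p \<in> P \<Longrightarrow> x \<in> Z \<Longrightarrow> x \<in> p \<Longrightarrow> x < l p"
    by metis
  have "\<exists>r. r \<notin> p \<and> (\<forall>x\<in>Z. x \<notin> p \<longrightarrow> r < x)" if p: "p \<in> P" for p
  proof -
    obtain e where e: "e \<notin> p" using P(4) p by (metis UNIV_eq_I)
    define m where "m = Min (insert e (Z - p))"
    have "m \<in> - p" using Min_in[of "insert e (Z - p)"] e Z unfolding m_def by auto
    then obtain r where "r \<in> - p" "r < m" using P(2)[OF p] unfolding is_gap_def by metis
    moreover have "m \<le> x" if "x \<in> Z" "x \<notin> p" for x
      unfolding m_def by (rule Min_le) (use Z that in auto)
    ultimately show ?thesis by (meson ComplD order_less_le_trans)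
  qed
  then obtain r where r: "\<And>p. p \<in> P \<Longrightarrow> r p \<notin> p" "\<And>p x. p \<in> P \<Longrightarrow> x \<in> Z \<Longrightarrow> x \<notin> p \<Longrightarrow> r p < x"
    by metis
  define L where "L = l ` P \<union> r ` P"
  have "finite L" using P(1) by (simp add: L_def)
  \<comment> \<open>Each x in S lies on the same side of every chosen point as \<phi> x, so \<phi>
    on S and the identity on \<open>L\<close> combine to a strictly increasing map.\<close>
  have sep: "(x < t \<longrightarrow> \<phi> x < t) \<and> (t < x \<longrightarrow> t < \<phi> x) \<and> x \<noteq> t" if x: "x \<in> S" and t: "t \<in> L" for x t
  proof -
    have xZ: "x \<in> Z" "\<phi> x \<in> Z" using x by (auto simp: Z_def)
    obtain p where p: "p \<in> P" "t = l p \<or> t = r p" using t by (auto simp: L_def)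
    have "\<phi> x < l p \<and> x < l p \<and> \<phi> x < r p \<and> x < r p" if "x \<in> p"
    proof -
      have "\<phi> x \<in> p" using that S(3)[OF p(1) x] by simp
      moreover have "l p < r p" using l(1) r(1) p(1) down by (meson not_le)
      ultimately show ?thesis using l(2)[OF p(1) xZ(1)] l(2)[OF p(1) xZ(2)] that by auto
    qed
    moreover have "l p < \<phi> x \<and> l p < x \<and> r p < \<phi> x \<and> r p < x" if "x \<notin> p"
    proof -
      have "\<phi> x \<notin> p" using that S(3)[OF p(1) x] by simp
      moreover have "l p < r p" using l(1) r(1) p(1) down by (meson not_le)
      ultimately show ?thesis using r(2)[OF p(1) xZ(1)] r(2)[OF p(1) xZ(2)] that by auto
    qed
    ultimately show ?thesis using p(2) by (cases "x \<in> p") auto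
  qed
  obtain g where g: "g \<in> G" "\<And>x. x \<in> S \<union> L \<Longrightarrow> g x = (if x \<in> S then \<phi> x else x)"
  proof (rule Aut_extends[of "S \<union> L" "\<lambda>x. if x \<in> S then \<phi> x else x"])
    show "finite (S \<union> L)" using S(1) \<open>finite L\<close> by simp
    show "strict_mono_on (S \<union> L) (\<lambda>x. if x \<in> S then \<phi> x else x)"
      using S(2) sep unfolding strict_mono_on_def by auto
  qed blast
  have gl: "g (l p) = l p" and gr: "g (r p) = r p" if "p \<in> P" for p
    using g(2)[of "l p"] g(2)[of "r p"] that sep[of "l p" "l p"] sep[of "r p" "r p"]
    by (auto simp: L_def)
  \<comment> \<open>Since g fixes the ends of the intervals, it maps \<open>M\<close> onto itself,
    so it can be altered inside \<open>M\<close> alone.\<close>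
  define M where "M = (\<Union>p\<in>P. {l p<..<r p})"
  have gM: "g x \<in> M \<longleftrightarrow> x \<in> M" for x
  proof -
    have "g x \<in> {l p<..<r p} \<longleftrightarrow> x \<in> {l p<..<r p}" if "p \<in> P" for p
      using Aut_less_iff[OF g(1), of "l p" x] Aut_less_iff[OF g(1), of x "r p"] gl[OF that] gr[OF that] by simp
    then show ?thesis by (simp add: M_def)
  qed
  \<comment> \<open>Making \<open>g\<close> the identity on an interval around each gap forces it to fix the gap.\<close>
  define w where "w x = (if x \<in> M then x else g x)" for x
  have M_less: "x < g y" if x: "x \<in> M" and "y \<notin> M" "x < y" for x y
  proof -
    obtain p where p: "p \<in> P" "l p < x" "x < r p" using x by (auto simp: M_def)
    then have "r p \<le> y" using that(2,3) by (force simp: M_def)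
    then show ?thesis using Aut_le_iff[OF g(1), of "r p" y] gr[OF p(1)] p(3) by simp
  qed
  have less_M: "g y < x" if x: "x \<in> M" and "y \<notin> M" "y < x" for x y
  proof -
    obtain p where p: "p \<in> P" "l p < x" "x < r p" using x by (auto simp: M_def)
    then have "y \<le> l p" using that(2,3) by (force simp: M_def)
    then show ?thesis using Aut_le_iff[OF g(1), of y "l p"] gl[OF p(1)] p(2) by simp
  qed
  have "strict_mono w"
    unfolding strict_mono_def w_def using M_less less_M Aut_less_iff[OF g(1)] by simp
  moreover have "surj w"
  proof (rule surjI)
    show "w (if y \<in> M then y else inv g y) = y" for y
      using gM[of "inv g y"] by (simp add: w_def Aut_apply_inv[OF g(1)])
  qed
  ultimately have wG: "w \<in> G" by (simp add: Aut_def)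
  \<comment> \<open>On \<open>M\<close> nothing moves; off \<open>M\<close> a point lies at or
    beyond l p or r p, and g, fixing both, keeps it on its side of the gap.\<close>
  have w_iff: "w x \<in> p \<longleftrightarrow> x \<in> p" if p: "p \<in> P" for x p
  proof (cases "x \<in> M")
    case False
    then have "x \<le> l p \<or> r p \<le> x" using p by (force simp: M_def)
    then show ?thesis
    proof
      assume x: "x \<le> l p"
      then have "g x \<le> l p" using Aut_le_iff[OF g(1), of x "l p"] gl[OF p] by simp
      then show ?thesis using x down[OF p l(1)[OF p]] False by (simp add: w_def)
    next
      assume x: "r p \<le> x"
      then have "r p \<le> g x" using Aut_le_iff[OF g(1), of "r p" x] gr[OF p] by simp
      then show ?thesis using x down[OF p] r(1)[OF p] False by (auto simp: w_def)
    qed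
  qed (simp add: w_def)
  show thesis
  proof (rule that[OF wG])
    show "w ` p = p" if "p \<in> P" for p
    proof (rule set_eqI)
      show "x \<in> w ` p \<longleftrightarrow> x \<in> p" for x
        using w_iff[OF that, of "inv w x"] by (simp add: Aut_image_mem_iff[OF wG] Aut_apply_inv[OF wG])
    qed
    show "w x = \<phi> x" if x: "x \<in> S" for x
    proof -
      have "x \<notin> M"
      proof
        assume "x \<in> M"
        then obtain p where p: "p \<in> P" "l p < x" "x < r p" by (auto simp: M_def)
        have "x \<in> Z" using x by (simp add: Z_def)
        then show False using l(2)[OF p(1), of x] r(2)[OF p(1), of x] p by fastforce
      qed
      then show ?thesis using g(2)[of x] x by (simp add: w_def)
    qed
  qed
qed

text \<open>\<phi> x and x have the same position relative to every cut in \<open>P\<close>. Gaps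
  are treated by \<open>Aut_fixing_cuts_gaps\<close>, cuts \<open>{..t}\<close> by adding t to the
  domain as a fixed point, and inf and sup are fixed by every automorphism.\<close>

lemma Aut_fixing_cuts:
  fixes \<phi> :: "'a \<Rightarrow> 'a"
  assumes P: "finite P" "P \<subseteq> K" and S: "finite S" "strict_mono_on S \<phi>"
    and eq: "\<And>p x. p \<in> P \<Longrightarrow> x \<in> S \<Longrightarrow> {..\<phi> x} = p \<longleftrightarrow> {..x} = p"
    and less: "\<And>p x. p \<in> P \<Longrightarrow> x \<in> S \<Longrightarrow> {..\<phi> x} \<subset> p \<longleftrightarrow> {..x} \<subset> p"
  obtains w where "w \<in> G" "\<And>p. p \<in> P \<Longrightarrow> w ` p = p" "\<And>x. x \<in> S \<Longrightarrow> w x = \<phi> x"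
proof -
  \<comment> \<open>In a chain without endpoints \<open>{}\<close> and \<open>UNIV\<close> satisfy
    \<open>is_gap\<close> too; they are set apart because points of X are chosen on both sides of
    each gap.\<close>
  define Q where "Q = {p\<in>P. is_gap p \<and> p \<noteq> {} \<and> p \<noteq> UNIV}"
  define T where "T = {t. {..t} \<in> P}"
  have "T = atMost -` P" by (auto simp: T_def)
  then have "finite T" using P(1) by (simp add: finite_vimageI inj_on_def)
  have mem: "x \<in> p \<longleftrightarrow> {..x} \<subset> p \<or> {..x} = p" if "p \<in> P" for p x
    using cmX_down_closed[of p] that P(2) by (metis (no_types, lifting) atMost_iff order_le_less order_refl subsetD subsetI)
  have T: "(x < t \<longrightarrow> \<phi> x < t) \<and> (t < x \<longrightarrow> t < \<phi> x) \<and> (x = t \<longrightarrow> \<phi> x = t)" if "x \<in> S" "t \<in> T" for x t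
    using eq[of "{..t}" x] less[of "{..t}" x] that unfolding T_def
    by (auto simp: atMost_psubset_atMost not_less_iff_gr_or_eq)
  let ?\<psi> = "\<lambda>x. if x \<in> S then \<phi> x else x"
  obtain w where w: "w \<in> G" "\<And>p. p \<in> Q \<Longrightarrow> w ` p = p" "\<And>x. x \<in> S \<union> T \<Longrightarrow> w x = ?\<psi> x"
  proof (rule Aut_fixing_cuts_gaps[of Q "S \<union> T" ?\<psi>])
    show "strict_mono_on (S \<union> T) ?\<psi>"
      using S(2) T unfolding strict_mono_on_def by auto
    show "?\<psi> x \<in> p \<longleftrightarrow> x \<in> p" if "p \<in> Q" "x \<in> S \<union> T" for p x
      using that eq[of p x] less[of p x] mem[of p x] mem[of p "\<phi> x"] by (auto simp: Q_def)
  qed (use P S \<open>finite T\<close> in \<open>auto simp: Q_def\<close>)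
  show thesis
  proof (rule that[OF w(1)])
    show "w ` p = p" if p: "p \<in> P" for p
    proof -
      consider t where "p = {..t}" | "p = {}" | "p = UNIV" | "p \<in> Q"
        using p P(2) by (auto simp: Q_def cmX_def)
      then show ?thesis
      proof cases
        case 1
        then have "t \<in> T" using p by (simp add: T_def)
        then have "w t = t" using w(3)[of t] T[of t t] by auto
        then show ?thesis using 1 Aut_image_atMost[OF w(1)] by simp
      qed (use w(2) Aut_surj[OF w(1)] in simp_all)
    qed
    show "w x = \<phi> x" if "x \<in> S" for x using w(3)[of x] that by simp
  qed
qed

section \<open>Stabiliser entourages from nearness of images\<close>

text \<open>When a x < x < b x this is a neighbourhood of the diagonal, obtained from the cover of
  c_m X by an interval around x and the two rays ending at x. Near cuts that do not lie strictly on
  the same side of x are both confined to the interval.\<close>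

definition near :: "('a \<Rightarrow> 'a) \<Rightarrow> ('a \<Rightarrow> 'a) \<Rightarrow> 'a \<Rightarrow> ('a set \<times> 'a set) set" where
  "near a b x = (let A = {p \<in> K. {..a x} \<subset> p \<and> p \<subset> {..b x}}; L = {p \<in> K. p \<subset> {..x}}; R = {p \<in> K. {..x} \<subset> p}
     in A \<times> A \<union> L \<times> L \<union> R \<times> R)"

lemma near_cases:
  assumes "(p, q) \<in> near a b x"
  obtains "{..a x} \<subset> p" "p \<subset> {..b x}" "{..a x} \<subset> q" "q \<subset> {..b x}"
    | "p \<subset> {..x}" "q \<subset> {..x}" | "{..x} \<subset> p" "{..x} \<subset> q"
  using assms unfolding near_def Let_def
  by (elim UnE SigmaE2 CollectE conjE) (rule that; assumption)+

lemma openin_near: "openin (prod_topology cm_top cm_top) (near a b x)"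
  unfolding near_def Let_def
  by (intro openin_Un) (simp_all add: openin_prod_Times_iff openin_cm_less openin_cm_greater openin_cm_interval)

lemma diag_near:
  assumes "a x < x" "x < b x" "p \<in> K" shows "(p, p) \<in> near a b x"
proof -
  have "{..a x} \<subset> {..x}" "{..x} \<subset> {..b x}" using assms by (simp_all add: atMost_psubset_atMost)
  moreover have "p \<subset> {..x} \<or> p = {..x} \<or> {..x} \<subset> p" using cmX_linear[OF assms(3), of "{..x}"] by auto
  ultimately show ?thesis using assms(3) unfolding near_def Let_def by auto
qed

text \<open>The point y is to lie relative to the cuts g z as x lies relative to the cuts h z. If x
  is one of the h z, then y must be its image under \<open>g \<circ> inv h\<close>, which nearness
  puts into the interval; otherwise y is chosen between the g z with h z below x and those with h z
  above x.\<close>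

lemma near_target:
  fixes \<sigma> :: "'a set set"
  assumes ab: "a x < x" "x < b x" and \<sigma>: "finite \<sigma>" "\<sigma> \<subseteq> K" and gh: "g \<in> G" "h \<in> G"
    and near: "\<And>z. z \<in> \<sigma> \<Longrightarrow> (g ` z, h ` z) \<in> near a b x"
  shows "\<exists>y. a x < y \<and> y < b x \<and>
    (\<forall>z\<in>\<sigma>. ({..y} = g ` z \<longleftrightarrow> {..x} = h ` z) \<and> ({..y} \<subset> g ` z \<longleftrightarrow> {..x} \<subset> h ` z))"
proof (cases "\<exists>z\<in>\<sigma>. {..x} = h ` z")
  case True
  then obtain z0 where z0: "z0 \<in> \<sigma>" "{..x} = h ` z0" by blast
  define v where "v = g \<circ> inv h"
  have v: "v \<in> G" unfolding v_def using gh by (intro comp_in_Aut inv_in_Aut)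
  have vh: "v ` h ` z = g ` z" for z
    unfolding v_def image_comp[symmetric] by (simp only: Aut_inv_image[OF gh(2)])
  have vx: "{..v x} = v ` {..x}" by (simp only: Aut_image_atMost[OF v])
  have "{..v x} = g ` z0" using z0(2) vh vx by metis
  moreover have "{..a x} \<subset> g ` z0 \<and> g ` z0 \<subset> {..b x}"
    by (rule near_cases[OF near[OF z0(1)]]) (simp_all add: z0(2)[symmetric])
  ultimately have ineq: "a x < v x" "v x < b x" by (metis atMost_psubset_atMost)+
  have iff: "{..v x} = g ` z \<longleftrightarrow> {..x} = h ` z" "{..v x} \<subset> g ` z \<longleftrightarrow> {..x} \<subset> h ` z" for z
    unfolding vx vh[symmetric] by (simp_all only: Aut_image_eq[OF v] Aut_image_psubset[OF v])
  show ?thesis by (intro exI[of _ "v x"] conjI ballI ineq iff)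
next
  case False
  let ?A = "insert {..a x} ((`) g ` {z\<in>\<sigma>. h ` z \<subset> {..x}})"
  let ?B = "insert {..b x} ((`) g ` {z\<in>\<sigma>. {..x} \<subset> h ` z})"
  \<comment> \<open>Since h z is above x, either both cuts lie in the interval or both lie above x;
    in either case g z exceeds a x.\<close>
  have up: "{..a x} \<subset> g ` z" if "z \<in> \<sigma>" "{..x} \<subset> h ` z" for z
  proof -
    have ax: "{..a x} \<subset> {..x}" using ab by (simp add: atMost_psubset_atMost)
    show ?thesis
    proof (rule near_cases[OF near[OF that(1)]])
      assume "h ` z \<subset> {..x}"
      then show ?thesis using that(2) by (metis order_less_asym)
    next
      assume "{..x} \<subset> g ` z"
      then show ?thesis using ax by (rule order_less_trans[rotated])
    qed
  qed
  have down: "g ` z \<subset> {..b x}" if "z \<in> \<sigma>" "h ` z \<subset> {..x}" for z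
  proof -
    have bx: "{..x} \<subset> {..b x}" using ab by (simp add: atMost_psubset_atMost)
    show ?thesis
    proof (rule near_cases[OF near[OF that(1)]])
      assume "{..x} \<subset> h ` z"
      then show ?thesis using that(2) by (metis order_less_asym)
    next
      assume "g ` z \<subset> {..x}"
      then show ?thesis using bx by (rule order_less_trans)
    qed
  qed
  have updown: "g ` z \<subset> g ` z'" if "h ` z \<subset> {..x}" "{..x} \<subset> h ` z'" for z z'
    using order_less_trans[OF that] by (simp only: Aut_image_psubset[OF gh(1)] Aut_image_psubset[OF gh(2)])
  have ab': "{..a x} \<subset> {..b x}" using ab by (simp add: atMost_psubset_atMost)
  have "\<exists>y. (\<forall>p\<in>?A. p \<subset> {..y}) \<and> (\<forall>q\<in>?B. {..y} \<subset> q)"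
  proof (rule K_between_finite)
    show "\<forall>p\<in>?A. \<forall>q\<in>?B. p \<subset> q"
    proof (intro ballI)
      fix p q assume "p \<in> ?A" "q \<in> ?B"
      then show "p \<subset> q"
        by (elim insertE imageE CollectE conjE) (simp_all only: ab' up down updown)
    qed
    show "UNIV \<notin> ?A"
    proof
      assume "UNIV \<in> ?A"
      then show False
      proof (elim insertE imageE CollectE conjE)
        assume "UNIV = {..a x}" then show False using atMost_neq(2) by metis
      next
        fix z assume "UNIV = g ` z" "z \<in> \<sigma>" "h ` z \<subset> {..x}"
        then show False using down[of z] by (metis top.extremum_strict)
      qed
    qed
    show "{} \<notin> ?B"
    proof
      assume "{} \<in> ?B"
      then show False
      proof (elim insertE imageE CollectE conjE)
        assume "{} = {..b x}" then show False using atMost_neq(1) by metis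
      next
        fix z assume "{} = g ` z" "z \<in> \<sigma>" "{..x} \<subset> h ` z"
        then show False using up[of z] by (metis not_psubset_empty)
      qed
    qed
  qed (use \<sigma> Aut_image_cmX[OF gh(1)] in auto)
  then obtain y where y: "\<forall>p\<in>?A. p \<subset> {..y}" "\<forall>q\<in>?B. {..y} \<subset> q" by blast
  have "a x < y" "y < b x" using y by (simp_all add: atMost_psubset_atMost)
  moreover have "({..y} = g ` z \<longleftrightarrow> {..x} = h ` z) \<and> ({..y} \<subset> g ` z \<longleftrightarrow> {..x} \<subset> h ` z)" if z: "z \<in> \<sigma>" for z
  proof -
    have "h ` z \<subset> {..x} \<or> {..x} \<subset> h ` z"
      using False z cmX_linear[OF Aut_image_cmX[OF gh(2)], of z "{..x}"] \<sigma>(2) by (auto simp: psubset_eq)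
    then show ?thesis
    proof
      assume *: "h ` z \<subset> {..x}"
      have "g ` z \<in> ?A" by (intro insertI2 imageI CollectI conjI z *)
      then have "g ` z \<subset> {..y}" using y(1) by (rule bspec[rotated])
      then show ?thesis using * by (metis order_less_asym order_less_irrefl)
    next
      assume *: "{..x} \<subset> h ` z"
      have "g ` z \<in> ?B" by (intro insertI2 imageI CollectI conjI z *)
      then have "{..y} \<subset> g ` z" using y(2) by (rule bspec[rotated])
      then show ?thesis using * by (metis order_less_irrefl)
    qed
  qed
  ultimately show ?thesis by (intro exI[of _ y]) simp
qed

text \<open>\<open>v\<close> carries each h z to g z but may move x out of its box. Pulling the
  targets y x back by \<open>v\<close> gives points in the same position relative to the h z as x,
  so some w fixing all h z realises them, and \<open>v \<circ> w\<close> has both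
  properties.\<close>

lemma near_imp_translate:
  fixes \<sigma> :: "'a set set"
  assumes S: "finite S" "\<And>x. x \<in> S \<Longrightarrow> a x < x \<and> x < b x"
    "\<And>x y. x \<in> S \<Longrightarrow> y \<in> S \<Longrightarrow> x < y \<Longrightarrow> b x < a y"
    and \<sigma>: "finite \<sigma>" "\<sigma> \<subseteq> K" and gh: "g \<in> G" "h \<in> G"
    and near: "\<And>z x. z \<in> \<sigma> \<Longrightarrow> x \<in> S \<Longrightarrow> (g ` z, h ` z) \<in> near a b x"
  shows "\<exists>u\<in>G. (\<forall>x\<in>S. a x < u x \<and> u x < b x) \<and> (\<forall>z\<in>\<sigma>. u ` h ` z = g ` z)"
proof -
  have "\<exists>y. x \<in> S \<longrightarrow> a x < y \<and> y < b x \<and>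
    (\<forall>z\<in>\<sigma>. ({..y} = g ` z \<longleftrightarrow> {..x} = h ` z) \<and> ({..y} \<subset> g ` z \<longleftrightarrow> {..x} \<subset> h ` z))" for x
  proof (cases "x \<in> S")
    case True
    then show ?thesis using near_target[of a x b \<sigma> g h] S(2)[OF True] \<sigma> gh near[OF _ True] by simp
  qed simp
  then obtain y where y: "\<And>x. x \<in> S \<Longrightarrow> a x < y x \<and> y x < b x"
    "\<And>x z. x \<in> S \<Longrightarrow> z \<in> \<sigma> \<Longrightarrow> {..y x} = g ` z \<longleftrightarrow> {..x} = h ` z"
    "\<And>x z. x \<in> S \<Longrightarrow> z \<in> \<sigma> \<Longrightarrow> {..y x} \<subset> g ` z \<longleftrightarrow> {..x} \<subset> h ` z"
    by metis
  define v where "v = g \<circ> inv h"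
  have v: "v \<in> G" unfolding v_def using gh by (intro comp_in_Aut inv_in_Aut)
  have vh: "v ` h ` z = g ` z" for z
    unfolding v_def image_comp[symmetric] by (simp only: Aut_inv_image[OF gh(2)])
  have iv: "inv v \<in> G" using v by (rule inv_in_Aut)
  have at: "{..inv v c} = inv v ` {..c}" for c by (simp only: Aut_image_atMost[OF iv])
  have h: "h ` z = inv v ` g ` z" for z by (simp only: vh[symmetric] Aut_inv_image[OF v])
  obtain w where w: "w \<in> G" "\<And>p. p \<in> (`) h ` \<sigma> \<Longrightarrow> w ` p = p" "\<And>x. x \<in> S \<Longrightarrow> w x = inv v (y x)"
  proof (rule Aut_fixing_cuts[of "(`) h ` \<sigma>" S "\<lambda>x. inv v (y x)"])
    show "(`) h ` \<sigma> \<subseteq> K" using \<sigma>(2) Aut_image_cmX[OF gh(2)] by auto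
    show "strict_mono_on S (\<lambda>x. inv v (y x))"
    proof (rule strict_mono_onI)
      fix r s assume rs: "r \<in> S" "s \<in> S" "r < s"
      have "y r < b r" "b r < a s" "a s < y s" using y(1) S(3) rs by auto
      then have "y r < y s" by (meson order_less_trans)
      then show "inv v (y r) < inv v (y s)" by (simp add: Aut_less_iff[OF iv])
    qed
    show "{..inv v (y x)} = p \<longleftrightarrow> {..x} = p" if p: "p \<in> (`) h ` \<sigma>" and x: "x \<in> S" for p x
    proof -
      obtain z where z: "z \<in> \<sigma>" "p = h ` z" using p by blast
      have "{..inv v (y x)} = p \<longleftrightarrow> {..y x} = g ` z"
        unfolding z(2) at h by (rule Aut_image_eq[OF iv])
      then show ?thesis using y(2)[OF x z(1)] z(2) by simp
    qed
    show "{..inv v (y x)} \<subset> p \<longleftrightarrow> {..x} \<subset> p" if p: "p \<in> (`) h ` \<sigma>" and x: "x \<in> S" for p x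
    proof -
      obtain z where z: "z \<in> \<sigma>" "p = h ` z" using p by blast
      have "{..inv v (y x)} \<subset> p \<longleftrightarrow> {..y x} \<subset> g ` z"
        unfolding z(2) at h by (rule Aut_image_psubset[OF iv])
      then show ?thesis using y(3)[OF x z(1)] z(2) by simp
    qed
  qed (use \<sigma>(1) S(1) in auto)
  show ?thesis
  proof (intro bexI[of _ "v \<circ> w"] conjI ballI)
    show "v \<circ> w \<in> G" using v w(1) by (rule comp_in_Aut)
    show "a x < (v \<circ> w) x" "(v \<circ> w) x < b x" if "x \<in> S" for x
      using y(1)[OF that] by (simp_all add: w(3)[OF that] Aut_apply_inv[OF v])
    show "(v \<circ> w) ` h ` z = g ` z" if "z \<in> \<sigma>" for z
    proof -
      have "w ` h ` z = h ` z" using w(2) that by blast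
      then show ?thesis unfolding image_comp[symmetric, of v] by (simp only: vh)
    qed
  qed
qed

text \<open>Nearness for all x in S gives u in U with u (h z) = g z on \<sigma>. Then g and h both
  lie in U h St_\<sigma>, so the pair belongs to E.\<close>

lemma R_Sigma_subset_V_G: "R_Sigma G tau_p cm_act K \<subseteq> V_G G"
proof
  fix E assume "E \<in> R_Sigma G tau_p cm_act K"
  then obtain U \<sigma> where E: "E \<subseteq> G \<times> G" and U: "openin tau_p U" "id \<in> U"
    and \<sigma>: "finite \<sigma>" "\<sigma> \<subseteq> K"
    and sub: "\<forall>g\<in>G. dcoset U g (Stab G cm_act \<sigma>) \<times> dcoset U g (Stab G cm_act \<sigma>) \<subseteq> E"
    unfolding mem_R_Sigma_iff by blast
  obtain S and a b :: "'a \<Rightarrow> 'a" where S: "finite S" "S \<noteq> {}" "\<And>x. x \<in> S \<Longrightarrow> a x < x \<and> x < b x"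
    "\<And>x y. x \<in> S \<Longrightarrow> y \<in> S \<Longrightarrow> x < y \<Longrightarrow> b x < a y"
    "\<And>u. u \<in> G \<Longrightarrow> (\<And>x. x \<in> S \<Longrightarrow> a x < u x \<and> u x < b x) \<Longrightarrow> u \<in> U"
    using tau_p_nhd_id[OF U] by metis
  define W where "W = (\<Inter>x\<in>S. near a b x)"
  have "openin (prod_topology cm_top cm_top) W"
    unfolding W_def using S(1,2) openin_near by (intro openin_Inter) auto
  moreover have "\<forall>z\<in>K. (z, z) \<in> W"
    unfolding W_def using S(3) diag_near by blast
  moreover have "(g, h) \<in> E" if gh: "g \<in> G" "h \<in> G" and near: "\<forall>z\<in>\<sigma>. (cm_act g z, cm_act h z) \<in> W" for g h
  proof -
    have near': "(g ` z, h ` z) \<in> near a b x" if "z \<in> \<sigma>" "x \<in> S" for z x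
      using near that by (auto simp: W_def cm_act_def)
    have "\<exists>u\<in>G. (\<forall>x\<in>S. a x < u x \<and> u x < b x) \<and> (\<forall>z\<in>\<sigma>. u ` h ` z = g ` z)"
      by (rule near_imp_translate[OF S(1) _ _ \<sigma> gh]) (simp_all add: S(3,4) near')
    then obtain u where u: "u \<in> G" "\<And>x. x \<in> S \<Longrightarrow> a x < u x \<and> u x < b x" "\<And>z. z \<in> \<sigma> \<Longrightarrow> u ` h ` z = g ` z"
      by metis
    \<comment> \<open>Solving g = u h s for s gives an automorphism fixing \<sigma>, as u h and g
      agree there.\<close>
    define s where "s = inv h \<circ> inv u \<circ> g"
    have sG: "s \<in> G" unfolding s_def using gh u(1) by (intro comp_in_Aut inv_in_Aut)
    have "s ` z = z" if "z \<in> \<sigma>" for z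
    proof -
      have "s ` z = inv h ` inv u ` g ` z" by (simp add: s_def image_image)
      then show ?thesis by (simp only: u(3)[OF that, symmetric] Aut_inv_image[OF u(1)] Aut_inv_image[OF gh(2)])
    qed
    then have "s \<in> Stab G cm_act \<sigma>" using sG by (simp add: Stab_def cm_act_def)
    moreover have "g = u \<circ> h \<circ> s"
      by (simp add: fun_eq_iff s_def Aut_apply_inv gh(2) u(1))
    moreover have "u \<in> U" using S(5) u(1,2) by blast
    ultimately have "g \<in> dcoset U h (Stab G cm_act \<sigma>)" unfolding dcoset_def by blast
    moreover have "h = id \<circ> h \<circ> id" by simp
    moreover have "id \<in> Stab G cm_act \<sigma>" by (rule id_in_Stab) (simp add: cm_act_def)
    ultimately have "h \<in> dcoset U h (Stab G cm_act \<sigma>)" "g \<in> dcoset U h (Stab G cm_act \<sigma>)"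
      using U(2) unfolding dcoset_def by blast+
    then show ?thesis using sub gh(2) by blast
  qed
  ultimately show "E \<in> V_G G"
    unfolding V_G_def using E \<sigma> by blast
qed

section \<open>Comparison with the Roelcke uniformity\<close>

text \<open>U contains the stabiliser of a finite subset of X, so the cover by sets U g St refines
  the cover by sets U g U.\<close>

lemma Roelcke_unif_subset_R_Sigma: "Roelcke_unif G tau_p \<subseteq> R_Sigma G tau_p cm_act K"
proof
  fix E assume "E \<in> Roelcke_unif G tau_p"
  then obtain U where E: "E \<subseteq> G \<times> G" and U: "openin tau_p U" "id \<in> U"
    and sub: "\<forall>g\<in>G. dcoset U g U \<times> dcoset U g U \<subseteq> E"
    unfolding mem_Roelcke_unif_iff by blast
  obtain S :: "'a set" where S: "finite S" "S \<noteq> {}" "Stab G (\<lambda>g. g) S \<subseteq> U"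
    using Stab_subset_nhd_id[OF U] by metis
  have "dcoset U g (Stab G cm_act (atMost ` S)) \<subseteq> dcoset U g U" for g
    using S(3) unfolding Stab_atMost dcoset_def by blast
  then have "\<forall>g\<in>G. dcoset U g (Stab G cm_act (atMost ` S)) \<times> dcoset U g (Stab G cm_act (atMost ` S)) \<subseteq> E"
    using sub by (meson Sigma_mono subset_trans)
  then show "E \<in> R_Sigma G tau_p cm_act K"
    unfolding mem_R_Sigma_iff using E U S
    by (intro conjI exI[of _ U] exI[of _ "atMost ` S"]) auto
qed

text \<open>x is moved up to c, below the next point of S and inside its own box if it has one,
  while the other points of S stay fixed.\<close>

lemma nhd_id_moves_point:
  assumes "openin tau_p U" "id \<in> U"
  obtains u where "u \<in> U" "(x :: 'a) < u x"
proof -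
  obtain S and a b :: "'a \<Rightarrow> 'a" where S: "finite S" "\<And>x. x \<in> S \<Longrightarrow> a x < x \<and> x < b x"
    "\<And>x y. x \<in> S \<Longrightarrow> y \<in> S \<Longrightarrow> x < y \<Longrightarrow> b x < a y"
    "\<And>u. u \<in> G \<Longrightarrow> (\<And>x. x \<in> S \<Longrightarrow> a x < u x \<and> u x < b x) \<Longrightarrow> u \<in> U"
    using tau_p_nhd_id[OF assms] by metis
  have "\<exists>c. (\<forall>z\<in>{x}. z < c) \<and> (\<forall>z\<in>{s\<in>S. x < s} \<union> b ` (S \<inter> {x}). c < z)"
    by (rule between_finite) (use S(1,2) in auto)
  then obtain c where c: "x < c" "\<And>s. s \<in> S \<Longrightarrow> x < s \<Longrightarrow> c < s" "x \<in> S \<Longrightarrow> c < b x"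
    by auto
  have "strict_mono_on (insert x S) (id(x := c))"
    using c(1,2) by (auto simp: strict_mono_on_def)
  then obtain u where u: "u \<in> G" "\<And>s. s \<in> insert x S \<Longrightarrow> u s = (id(x := c)) s"
    using Aut_extends[of "insert x S"] S(1) by blast
  have "a s < u s \<and> u s < b s" if "s \<in> S" for s
    using u(2)[of s] S(2)[OF that] c that by (cases "s = x") auto
  then have "u \<in> U" using S(4) u(1) by blast
  then show thesis using that u(2)[of x] c(1) by simp
qed

lemma V_G_not_subset_Roelcke_unif: "\<exists>E. E \<in> V_G G \<and> E \<notin> Roelcke_unif G tau_p"
proof -
  obtain y y' :: 'a where yy: "y < y'" using gt_ex by blast
  fix x :: 'a
  \<comment> \<open>The two rays overlap between y and y' and so cover c_m X, but neither contains
    both y and y'.\<close>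
  define W where "W = {p \<in> K. p \<subset> {..y'}} \<times> {p \<in> K. p \<subset> {..y'}} \<union> {p \<in> K. {..y} \<subset> p} \<times> {p \<in> K. {..y} \<subset> p}"
  define E where "E = {(g, h). g \<in> G \<and> h \<in> G \<and> (\<forall>z\<in>{{..x}}. (cm_act g z, cm_act h z) \<in> W)}"
  have "openin (prod_topology cm_top cm_top) W"
    unfolding W_def by (intro openin_Un) (simp_all add: openin_prod_Times_iff openin_cm_less openin_cm_greater)
  moreover have "(z, z) \<in> W" if z: "z \<in> K" for z
  proof (cases "{..y} \<subset> z")
    case False
    then have "z \<subseteq> {..y}" using cmX_not_subset[OF z, of "{..y}"] by auto
    then have "z \<subset> {..y'}" using yy atMost_psubset_atMost by (metis order_le_less_trans)
    then show ?thesis using z by (simp add: W_def)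
  qed (use z in \<open>simp add: W_def\<close>)
  moreover have "E \<subseteq> G \<times> G" by (auto simp: E_def)
  ultimately have "E \<in> V_G G"
    unfolding V_G_def E_def
    by (intro CollectI conjI exI[of _ "{{..x}}"] exI[of _ W]) auto
  moreover have "E \<notin> Roelcke_unif G tau_p"
  proof
    assume "E \<in> Roelcke_unif G tau_p"
    then obtain U where U: "openin tau_p U" "id \<in> U"
      and sub: "\<forall>g\<in>G. dcoset U g U \<times> dcoset U g U \<subseteq> E"
      unfolding mem_Roelcke_unif_iff by blast
    obtain u where u: "u \<in> U" "x < u x" using nhd_id_moves_point[OF U] by metis
    \<comment> \<open>However little u moves x, k takes x and u x to y and y', and both k and
      \<open>k \<circ> u\<close> lie in U k U.\<close>
    obtain k where k: "k \<in> G" "k x = y" "k (u x) = y'" using Aut_2_transitive[OF u(2) yy] by metis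
    have "k = id \<circ> k \<circ> id" "k \<circ> u = id \<circ> k \<circ> u" by simp_all
    then have "k \<in> dcoset U k U" "k \<circ> u \<in> dcoset U k U" using U(2) u(1) unfolding dcoset_def by blast+
    then have "(k, k \<circ> u) \<in> E" using sub k(1) by blast
    then have "(cm_act k {..x}, cm_act (k \<circ> u) {..x}) \<in> W" "k \<circ> u \<in> G" by (auto simp: E_def)
    then have "({..y}, {..y'}) \<in> W"
      using Aut_image_atMost[OF k(1), of x] Aut_image_atMost[of "k \<circ> u" x] k by (simp add: cm_act_def)
    then show False unfolding W_def by blast
  qed
  ultimately show ?thesis by blast
qed

section \<open>Roelcke precompactness\<close>

text \<open>Equal order types make the prescription of fixing S and sending k t to h t strictly
  increasing; an extension w gives h = w k s with s fixing S.\<close>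

lemma same_type_imp_Stab_dcoset:
  fixes S :: "'a set"
  assumes S: "finite S" and kh: "k \<in> G" "h \<in> G"
    and less: "\<And>s t. s \<in> S \<Longrightarrow> t \<in> S \<Longrightarrow> s < k t \<longleftrightarrow> s < h t"
    and eq: "\<And>s t. s \<in> S \<Longrightarrow> t \<in> S \<Longrightarrow> s = k t \<longleftrightarrow> s = h t"
  shows "h \<in> dcoset (Stab G (\<lambda>g. g) S) k (Stab G (\<lambda>g. g) S)"
proof -
  \<comment> \<open>If some k t lies in S, the hypothesis on equalities gives h t = k t, so the two
    prescriptions agree.\<close>
  define \<psi> where "\<psi> x = (if x \<in> S then x else h (inv k x))" for x
  have \<psi>k: "\<psi> (k t) = h t" if "t \<in> S" for t
    using eq[of "k t" t] that by (auto simp: \<psi>_def Aut_inv_apply[OF kh(1)])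
  have "\<psi> x < \<psi> y" if xy: "x \<in> S \<union> k ` S" "y \<in> S \<union> k ` S" "x < y" for x y
  proof -
    have gt: "h t < s" if "s \<in> S" "t \<in> S" "k t < s" for s t
      using less[of s t] eq[of s t] that by auto
    consider "x \<in> S" "y \<in> S" | t where "x \<in> S" "t \<in> S" "y = k t" | t where "y \<in> S" "t \<in> S" "x = k t"
      | s t where "s \<in> S" "t \<in> S" "x = k s" "y = k t"
      using xy by blast
    then show ?thesis
    proof cases
      case 1
      then show ?thesis using xy by (simp add: \<psi>_def)
    next
      case (2 t)
      then show ?thesis using xy less[of x t] \<psi>k[of t] by (simp add: \<psi>_def)
    next
      case (3 t)
      then show ?thesis using xy gt[of y t] \<psi>k[of t] by (simp add: \<psi>_def)
    next
      case (4 s t)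
      then show ?thesis using xy \<psi>k by (simp add: Aut_less_iff kh)
    qed
  qed
  then have "strict_mono_on (S \<union> k ` S) \<psi>" by (simp add: strict_mono_on_def)
  then obtain w where w: "w \<in> G" "\<And>x. x \<in> S \<union> k ` S \<Longrightarrow> w x = \<psi> x"
    using Aut_extends[of "S \<union> k ` S"] S by blast
  have "w x = x" if "x \<in> S" for x using w(2)[of x] that by (simp add: \<psi>_def)
  then have wS: "w \<in> Stab G (\<lambda>g. g) S" using w(1) by (simp add: Stab_def)
  define s where "s = inv k \<circ> inv w \<circ> h"
  have "s t = t" if "t \<in> S" for t
  proof -
    have "h t = w (k t)" using w(2)[of "k t"] \<psi>k[OF that] that by simp
    then show ?thesis by (simp add: s_def Aut_inv_apply w(1) kh(1))
  qed
  moreover have "s \<in> G" unfolding s_def using w(1) kh by (intro comp_in_Aut inv_in_Aut)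
  ultimately have "s \<in> Stab G (\<lambda>g. g) S" by (simp add: Stab_def)
  moreover have "h = w \<circ> k \<circ> s" by (simp add: fun_eq_iff s_def Aut_apply_inv w(1) kh(1))
  ultimately show ?thesis using wS unfolding dcoset_def by blast
qed

lemma Roelcke_precompact: "Roelcke_precompact G tau_p"
  unfolding Roelcke_precompact_def
proof (intro allI impI, elim conjE)
  fix U :: "('a \<Rightarrow> 'a) set" assume U: "openin tau_p U" "id \<in> U"
  obtain S :: "'a set" where S: "finite S" "Stab G (\<lambda>g. g) S \<subseteq> U"
    using Stab_subset_nhd_id[OF U] by metis
  define T where "T g = ({(s, t) \<in> S \<times> S. s < g t}, {(s, t) \<in> S \<times> S. s = g t})" for g :: "'a \<Rightarrow> 'a"
  have "T ` G \<subseteq> Pow (S \<times> S) \<times> Pow (S \<times> S)" by (auto simp: T_def)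
  moreover have "finite (Pow (S \<times> S) \<times> Pow (S \<times> S))" using S(1) by simp
  ultimately have "finite (T ` G)" by (rule finite_subset)
  \<comment> \<open>\<open>F\<close> takes one representative for each of the finitely many order
    types.\<close>
  then obtain F where F: "F \<subseteq> G" "finite F" "T ` G = T ` F"
    using finite_subset_image[of "T ` G" T G] by auto
  have "h \<in> (\<Union>g\<in>F. dcoset U g U)" if h: "h \<in> G" for h
  proof -
    obtain k where k: "k \<in> F" "T k = T h" using F(3) h by (metis imageE imageI)
    have "s < k t \<longleftrightarrow> s < h t" "s = k t \<longleftrightarrow> s = h t" if "s \<in> S" "t \<in> S" for s t
      using k(2) that unfolding T_def by (auto simp: set_eq_iff)
    then have "h \<in> dcoset (Stab G (\<lambda>g. g) S) k (Stab G (\<lambda>g. g) S)"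
      using same_type_imp_Stab_dcoset[OF S(1)] k(1) F(1) h by blast
    then show ?thesis using S(2) k(1) unfolding dcoset_def by blast
  qed
  then show "\<exists>F. finite F \<and> F \<subseteq> G \<and> G \<subseteq> (\<Union>g\<in>F. dcoset U g U)" using F by blast
qed

section \<open>Density of automorphisms among monotone maps\<close>

lemma Aut_extends_family:
  fixes X Y :: "'i \<Rightarrow> 'a"
  assumes "finite I" "\<And>i j. i \<in> I \<Longrightarrow> j \<in> I \<Longrightarrow> X i < X j \<Longrightarrow> Y i < Y j"
    "\<And>i j. i \<in> I \<Longrightarrow> j \<in> I \<Longrightarrow> X i = X j \<Longrightarrow> Y i = Y j"
  obtains g where "g \<in> G" "\<And>i. i \<in> I \<Longrightarrow> g (X i) = Y i"
proof -
  define \<phi> where "\<phi> x = Y (inv_into I X x)" for x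
  have \<phi>: "\<phi> (X i) = Y i" if "i \<in> I" for i
    unfolding \<phi>_def using assms(3) that by (meson f_inv_into_f imageI inv_into_into)
  have "strict_mono_on (X ` I) \<phi>"
    using assms(2) by (auto simp: strict_mono_on_def \<phi>)
  then obtain g where "g \<in> G" "\<And>x. x \<in> X ` I \<Longrightarrow> g x = \<phi> x"
    using Aut_extends[of "X ` I" \<phi>] assms(1) by blast
  then show thesis using that \<phi> by auto
qed

text \<open>Points l' p and r' p of X enclose each cut p and separate different cuts of \<sigma>; an
  automorphism taking them to a p and b p takes p strictly between these, even if p is a
  gap.\<close>

lemma Aut_approximates_above:
  fixes F :: "'a set \<Rightarrow> 'a set" and r :: "'a set \<Rightarrow> 'a"
  assumes \<sigma>: "finite \<sigma>" "\<sigma> \<subseteq> K" "{} \<notin> \<sigma>" "UNIV \<notin> \<sigma>"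
    and F: "\<And>p. p \<in> \<sigma> \<Longrightarrow> F p \<in> K" "\<And>p. p \<in> \<sigma> \<Longrightarrow> F p \<subset> {..r p}"
      "\<And>p q. p \<in> \<sigma> \<Longrightarrow> q \<in> \<sigma> \<Longrightarrow> p \<subset> q \<Longrightarrow> F p \<subseteq> F q"
  shows "\<exists>g\<in>G. \<forall>p\<in>\<sigma>. F p \<subset> g ` p \<and> g ` p \<subset> {..r p}"
proof -
  have "\<exists>a b. (\<forall>p\<in>\<sigma>. F p \<subset> {..a p} \<and> a p < b p \<and> b p < r p) \<and> (\<forall>p\<in>\<sigma>. \<forall>q\<in>\<sigma>. p \<subset> q \<longrightarrow> b p < a q)"
    by (rule strict_mono_interval_selection) (simp_all add: \<sigma> F)
  then obtain a b where ab [rule_format]: "\<forall>p\<in>\<sigma>. F p \<subset> {..a p} \<and> a p < b p \<and> b p < r p"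
    "\<forall>p\<in>\<sigma>. \<forall>q\<in>\<sigma>. p \<subset> q \<longrightarrow> b p < a q"
    by (elim exE conjE)
  have "\<exists>c. p \<in> \<sigma> \<longrightarrow> p \<subset> {..c} \<and> (\<forall>q\<in>\<sigma>. p \<subset> q \<longrightarrow> {..c} \<subset> q)" for p
  proof (cases "p \<in> \<sigma>")
    case True
    have "\<exists>c. (\<forall>x\<in>{p}. x \<subset> {..c}) \<and> (\<forall>x\<in>{q \<in> \<sigma>. p \<subset> q}. {..c} \<subset> x)"
      by (rule K_between_finite) (use \<sigma> True in auto)
    then show ?thesis by auto
  qed simp
  then obtain r' where r': "\<And>p. p \<in> \<sigma> \<Longrightarrow> p \<subset> {..r' p}" "\<And>p q. p \<in> \<sigma> \<Longrightarrow> q \<in> \<sigma> \<Longrightarrow> p \<subset> q \<Longrightarrow> {..r' p} \<subset> q"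
    by metis
  have "\<exists>c. p \<in> \<sigma> \<longrightarrow> {..c} \<subset> p \<and> (\<forall>q\<in>\<sigma>. q \<subset> p \<longrightarrow> {..r' q} \<subset> {..c})" for p
  proof (cases "p \<in> \<sigma>")
    case True
    have "\<exists>c. (\<forall>x\<in>(\<lambda>q. {..r' q}) ` {q \<in> \<sigma>. q \<subset> p}. x \<subset> {..c}) \<and> (\<forall>x\<in>{p}. {..c} \<subset> x)"
      by (rule K_between_finite) (use \<sigma> True r'(2) atMost_neq(2) in auto)
    then show ?thesis by auto
  qed simp
  then obtain l' where l': "\<And>p. p \<in> \<sigma> \<Longrightarrow> {..l' p} \<subset> p"
    "\<And>p q. p \<in> \<sigma> \<Longrightarrow> q \<in> \<sigma> \<Longrightarrow> q \<subset> p \<Longrightarrow> r' q < l' p"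
    unfolding atMost_psubset_atMost by metis
  have lr': "l' p < r' p" if "p \<in> \<sigma>" for p
    using order_less_trans[OF l'(1)[OF that] r'(1)[OF that]] by (simp add: atMost_psubset_atMost)
  \<comment> \<open>The Boolean index selects the right or the left end of the pair belonging to a
    cut.\<close>
  define X where "X i = (if snd i then r' (fst i) else l' (fst i))" for i
  define Y where "Y i = (if snd i then b (fst i) else a (fst i))" for i
  have YX: "X i < X j \<and> Y i < Y j" if "i \<in> \<sigma> \<times> UNIV" "j \<in> \<sigma> \<times> UNIV" "fst i \<subset> fst j" for i j
  proof -
    have m: "fst i \<in> \<sigma>" "fst j \<in> \<sigma>" using that by auto
    show ?thesis
      using lr'[OF m(1)] lr'[OF m(2)] l'(2)[OF m(2,1) that(3)] ab(1)[OF m(1)] ab(1)[OF m(2)] ab(2)[OF m that(3)]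
      unfolding X_def Y_def by (auto intro: order_less_trans)
  qed
  have tri: "i = j \<or> (X i < X j \<and> Y i < Y j) \<or> (X j < X i \<and> Y j < Y i)"
    if ij: "i \<in> \<sigma> \<times> UNIV" "j \<in> \<sigma> \<times> UNIV" for i j
  proof -
    have m: "fst i \<in> \<sigma>" "fst j \<in> \<sigma>" using that by auto
    consider "fst i = fst j" | "fst i \<subset> fst j" | "fst j \<subset> fst i"
      using cmX_linear[of "fst i" "fst j"] m \<sigma>(2) by blast
    then show ?thesis
    proof cases
      case 1
      then show ?thesis using lr'[OF m(1)] ab(1)[OF m(1)] by (auto simp: X_def Y_def prod_eq_iff)
    qed (use YX ij in auto)
  qed
  obtain g where g: "g \<in> G" "\<And>i. i \<in> \<sigma> \<times> UNIV \<Longrightarrow> g (X i) = Y i"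
  proof (rule Aut_extends_family[of "\<sigma> \<times> UNIV" X Y])
    show "finite (\<sigma> \<times> (UNIV :: bool set))" using \<sigma>(1) by simp
    show "Y i < Y j" if "i \<in> \<sigma> \<times> UNIV" "j \<in> \<sigma> \<times> UNIV" "X i < X j" for i j
      using tri[OF that(1,2)] that(3) by auto
    show "Y i = Y j" if "i \<in> \<sigma> \<times> UNIV" "j \<in> \<sigma> \<times> UNIV" "X i = X j" for i j
      using tri[OF that(1,2)] that(3) by auto
  qed blast
  have "F p \<subset> g ` p \<and> g ` p \<subset> {..r p}" if p: "p \<in> \<sigma>" for p
  proof -
    have gl: "g (l' p) = a p" and gr: "g (r' p) = b p"
      using g(2)[of "(p, False)"] g(2)[of "(p, True)"] p by (simp_all add: X_def Y_def)
    have "{..a p} \<subset> g ` p"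
      using Aut_image_psubset[OF g(1), of "{..l' p}" p] l'(1)[OF p] by (simp add: Aut_image_atMost[OF g(1)] gl)
    moreover have "g ` p \<subset> {..b p}"
      using Aut_image_psubset[OF g(1), of p "{..r' p}"] r'(1)[OF p] by (simp add: Aut_image_atMost[OF g(1)] gr)
    moreover have "{..b p} \<subset> {..r p}" using ab(1)[OF p] by (simp add: atMost_psubset_atMost)
    ultimately show ?thesis using ab(1)[OF p] by (meson order_less_trans)
  qed
  then show ?thesis using g(1) by (intro bexI[of _ g]) simp_all
qed

text \<open>A basic neighbourhood constrains finitely many coordinates, and every automorphism
  already agrees with f at inf and sup. The other values are approached strictly from above; where f
  takes the value sup, it is first lowered to a common large point.\<close>

lemma monotone_imp_ellis:
  assumes f: "f \<in> extensional K" "\<And>z. z \<in> K \<Longrightarrow> f z \<in> K"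
    "\<And>x y. x \<in> K \<Longrightarrow> y \<in> K \<Longrightarrow> x \<subset> y \<Longrightarrow> f x \<subseteq> f y" "f {} = {}" "f UNIV = (UNIV :: 'a set)"
  shows "f \<in> ellis_cm"
  unfolding ellis_cm_def in_closure_of
proof (intro conjI allI impI)
  show "f \<in> topspace (product_topology (\<lambda>_. cm_top) K)" using f by (simp add: PiE_iff)
next
  fix T assume T: "f \<in> T \<and> openin (product_topology (\<lambda>_. cm_top) K) T"
  have "\<exists>V. finite {i \<in> K. V i \<noteq> K} \<and> (\<forall>i\<in>K. openin cm_top (V i)) \<and> f \<in> Pi\<^sub>E K V \<and> Pi\<^sub>E K V \<subseteq> T"
    using bspec[OF T[THEN conjunct2, unfolded openin_product_topology_alt topspace_cm_top] T[THEN conjunct1]] .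
  then obtain V where V: "finite {i \<in> K. V i \<noteq> K}" "\<forall>i\<in>K. openin cm_top (V i)"
    "f \<in> Pi\<^sub>E K V" "Pi\<^sub>E K V \<subseteq> T"
    by (elim exE conjE)
  define \<sigma> where "\<sigma> = {i \<in> K. V i \<noteq> K} - {{}, UNIV}"
  have \<sigma>: "finite \<sigma>" "\<sigma> \<subseteq> K" "{} \<notin> \<sigma>" "UNIV \<notin> \<sigma>" using V(1) by (auto simp: \<sigma>_def)
  have fV: "f p \<in> V p" if "p \<in> K" for p using V(3) that by (auto simp: PiE_iff)
  have "\<exists>l. p \<in> \<sigma> \<longrightarrow> f p = UNIV \<longrightarrow> (\<forall>q\<in>K. {..l} \<subset> q \<longrightarrow> q \<in> V p)" for p
  proof (cases "p \<in> \<sigma> \<and> f p = UNIV")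
    case True
    then have "openin cm_top (V p)" "UNIV \<in> V p" using V(2) fV[of p] \<sigma>(2) by auto
    then obtain l where "{..l} \<subset> UNIV" "\<And>q. q \<in> K \<Longrightarrow> {..l} \<subset> q \<Longrightarrow> q \<subseteq> UNIV \<Longrightarrow> q \<in> V p"
      by (rule openin_cm_left) simp_all
    then show ?thesis by (intro exI[of _ l]) simp
  qed simp
  then obtain l where l: "\<And>p q. p \<in> \<sigma> \<Longrightarrow> f p = UNIV \<Longrightarrow> q \<in> K \<Longrightarrow> {..l p} \<subset> q \<Longrightarrow> q \<in> V p"
    by metis
  \<comment> \<open>L exceeds every l p, so cuts above L are admissible wherever f p is sup, and it
    exceeds the remaining values of f on \<sigma>, so that F stays monotone.\<close>
  have "\<exists>L. (\<forall>x\<in>(\<lambda>p. {..l p}) ` \<sigma> \<union> (f ` \<sigma> - {UNIV}). x \<subset> {..L}) \<and> (\<forall>x\<in>{}. {..L} \<subset> x)"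
    by (rule K_between_finite) (use \<sigma> f(2) atMost_neq(2) in auto)
  then obtain L where "\<forall>x\<in>(\<lambda>p. {..l p}) ` \<sigma> \<union> (f ` \<sigma> - {UNIV}). x \<subset> {..L}"
    by (elim exE conjE)
  then have L: "{..l p} \<subset> {..L}" "f p \<noteq> UNIV \<Longrightarrow> f p \<subset> {..L}" if "p \<in> \<sigma>" for p
    using that by simp_all
  define F where "F p = (if f p = UNIV then {..L} else f p)" for p
  have "\<exists>r. p \<in> \<sigma> \<longrightarrow> F p \<subset> {..r} \<and> (\<forall>q\<in>K. F p \<subset> q \<longrightarrow> q \<subset> {..r} \<longrightarrow> q \<in> V p)" for p
  proof (cases "p \<in> \<sigma>")
    case p: True
    show ?thesis
    proof (cases "f p = UNIV")
      case True
      obtain r where "L < r" using gt_ex by blast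
      then have "F p \<subset> {..r}" using True by (simp add: F_def atMost_psubset_atMost)
      moreover have "q \<in> V p" if "q \<in> K" "F p \<subset> q" for q
        using l[OF p True that(1)] order_less_trans[OF L(1)[OF p]] that(2) True by (simp add: F_def)
      ultimately show ?thesis by (intro exI[of _ r]) simp
    next
      case False
      have "openin cm_top (V p)" "f p \<in> V p" using p V(2) fV \<sigma>(2) by auto
      then obtain r where "f p \<subset> {..r}" "\<And>q. q \<in> K \<Longrightarrow> q \<subset> {..r} \<Longrightarrow> f p \<subseteq> q \<Longrightarrow> q \<in> V p"
        by (rule openin_cm_right[OF _ _ False]) simp
      then show ?thesis using False by (intro exI[of _ r]) (simp add: F_def)
    qed
  qed simp
  then obtain r where r: "\<And>p. p \<in> \<sigma> \<Longrightarrow> F p \<subset> {..r p}"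
    "\<And>p q. p \<in> \<sigma> \<Longrightarrow> q \<in> K \<Longrightarrow> F p \<subset> q \<Longrightarrow> q \<subset> {..r p} \<Longrightarrow> q \<in> V p"
    by metis
  have "\<exists>g\<in>G. \<forall>p\<in>\<sigma>. F p \<subset> g ` p \<and> g ` p \<subset> {..r p}"
  proof (rule Aut_approximates_above[OF \<sigma> _ r(1)])
    show "F p \<in> K" if "p \<in> \<sigma>" for p using that f(2) \<sigma>(2) by (auto simp: F_def)
    show "F p \<subseteq> F q" if "p \<in> \<sigma>" "q \<in> \<sigma>" "p \<subset> q" for p q
    proof -
      have "f p \<subseteq> f q" using f(3)[OF _ _ that(3)] that(1,2) \<sigma>(2) by (simp add: subset_iff)
      moreover have "f p \<subseteq> {..L}" if "f p \<noteq> UNIV" using L(2)[OF \<open>p \<in> \<sigma>\<close> that] by (rule less_imp_le)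
      ultimately show ?thesis unfolding F_def by auto
    qed
  qed
  then obtain g where g: "g \<in> G" "\<And>p. p \<in> \<sigma> \<Longrightarrow> F p \<subset> g ` p \<and> g ` p \<subset> {..r p}" by (elim bexE) simp
  have gV: "g ` p \<in> V p" if p: "p \<in> K" for p
  proof -
    consider "p \<in> \<sigma>" | "p = {}" | "p = UNIV" | "V p = K" using p by (auto simp: \<sigma>_def)
    then show ?thesis
    proof cases
      case 1
      then show ?thesis using r(2)[OF 1 Aut_image_cmX[OF g(1) p]] g(2)[OF 1] by simp
    qed (use fV[OF p] f(4,5) Aut_surj[OF g(1)] Aut_image_cmX[OF g(1) p] in simp_all)
  qed
  have "iota_cm g \<in> Pi\<^sub>E K V" using gV by (simp add: iota_cm_def cm_act_def)
  then show "\<exists>y. y \<in> iota_cm ` G \<and> y \<in> T" using g(1) V(4) by blast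
qed

end

section \<open>The uniformities and the Ellis compactification identified\<close>

text \<open>Completions are compared through the uniformities they induce on G: coinciding
  completions become equal uniformities, and b_r G lying strictly below the Ellis compactification
  becomes a proper inclusion.\<close>

theorem mainTheorem13:
  assumes inf: "infinite (UNIV :: 'a::linorder_topology set)"
    and uh: "ultrahomogeneous TYPE('a)"
  shows "V_G (Aut :: ('a \<Rightarrow> 'a) set) = R_Sigma Aut tau_p cm_act (cmX :: 'a set set)
       \<and> Roelcke_precompact (Aut :: ('a \<Rightarrow> 'a) set) tau_p
       \<and> Roelcke_unif (Aut :: ('a \<Rightarrow> 'a) set) tau_p \<subset> V_G Aut
       \<and> (ellis_cm :: ('a set \<Rightarrow> 'a set) set) =
           {f \<in> extensional cmX. (\<forall>z\<in>cmX. f z \<in> cmX)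
              \<and> (\<forall>x\<in>cmX. \<forall>y\<in>cmX. x \<subset> y \<longrightarrow> f x \<subseteq> f y)
              \<and> f {} = {} \<and> f UNIV = UNIV}
       \<and> (continuously_ordered TYPE('a) \<longrightarrow>
           V_G (Aut :: ('a \<Rightarrow> 'a) set) = R_Sigma Aut tau_p (\<lambda>g. g) (UNIV :: 'a set))"
proof -
  interpret ultrahomogeneous_chain "TYPE('a)"
    by standard (rule inf, rule uh)
  have eq: "V_G G = R_Sigma G tau_p cm_act K"
    using V_G_subset_R_Sigma R_Sigma_subset_V_G by (rule subset_antisym)
  have "Roelcke_unif G tau_p \<subset> V_G G"
  proof (rule psubsetI)
    show "Roelcke_unif G tau_p \<subseteq> V_G G" using Roelcke_unif_subset_R_Sigma unfolding eq .
    show "Roelcke_unif G tau_p \<noteq> V_G G" using V_G_not_subset_Roelcke_unif by metis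
  qed
  moreover have "(ellis_cm :: ('a set \<Rightarrow> 'a set) set) =
           {f \<in> extensional cmX. (\<forall>z\<in>cmX. f z \<in> cmX)
              \<and> (\<forall>x\<in>cmX. \<forall>y\<in>cmX. x \<subset> y \<longrightarrow> f x \<subseteq> f y)
              \<and> f {} = {} \<and> f UNIV = UNIV}"
    (is "_ = ?M")
  proof (rule set_eqI)
    fix f :: "'a set \<Rightarrow> 'a set"
    have "f \<in> ?M" if "f \<in> ellis_cm" using ellis_imp_monotone[OF that] by simp
    moreover have "f \<in> ellis_cm" if "f \<in> ?M" using that by (intro monotone_imp_ellis) simp_all
    ultimately show "f \<in> ellis_cm \<longleftrightarrow> f \<in> ?M" by (rule iffI)
  qed
  moreover have "continuously_ordered TYPE('a) \<longrightarrow> V_G G = R_Sigma G tau_p (\<lambda>g. g) (UNIV :: 'a set)"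
    using eq R_Sigma_continuously_ordered by simp
  ultimately show ?thesis using eq Roelcke_precompact by (intro conjI)
qed

end
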